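(* (1) A unital commutative pro-$C^*$-algebra is barreled if and only if it is (isomorphic to one) of the form $C(X)$ with the compact-open topology, for some $T_{3\frac12}$ space $X$ such that all relatively pseudocompact subsets $A\subseteq X$ are relatively compact. (2) If $X$ is a functionally Hausdorff $\kappa$-space whose relatively pseudocompact subsets are all relatively compact, then the compact subspaces of the Tychonoff space $\tau X$ are precisely those of the original topology on $X$.
   Context: A pro-$C^*$-algebra is a cofiltered limit of $C^*$-algebras in the category of topological $*$-algebras; equivalently, a complete Hausdorff topological $*$-algebra over $\mathbb{C}$ whose topology is generated by its continuous $C^*$-seminorms. Isomorphism means isomorphism of topological $*$-algebras. $T_{3\frac12}$ (Tychonoff) means $T_1$ and completely regular. A space $X$ is functionally Hausdorff (functionally $T_2$) if any two distinct points are distinguished by some continuous real-valued function on $X$. A $\kappa$-space (compactly generated space) is a space $X$ in which $A\subseteq X$ is closed if and only if $A\cap K$ is closed in $K$ for every compact $K\subseteq X$. $\tau X$ denotes the universal Tychonoff space receiving a continuous map from $X$ (the Tychonoff reflection); for functionally Hausdorff $X$ it is the set $X$ with the weakest topology making all continuous real-valued functions on the original space $X$ continuous. $C(X)$ denotes the algebra of continuous complex-valued functions; the compact-open topology is that of uniform convergence on all compact subsets of $X$. A subset $A\subseteq X$ is relatively compact if its closure in $X$ is compact, and relatively pseudocompact if every continuous real-valued function on $X$ is bounded on $A$. A locally convex topological vector space is barreled if every barrel (absolutely convex, absorbing, closed subset) is a neighborhood of the origin. *)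

theory Defs
  imports
    "HOL-Algebra.Module"
    "HOL-Algebra.QuotRing"
    "HOL-Analysis.Analysis"
begin

record 'a top_star_algebra = "(complex, 'a) module" +
  star :: "'a \<Rightarrow> 'a"
  alg_topology :: "'a topology"

definition complex_ring :: "complex ring" where
  "complex_ring = \<lparr> carrier = UNIV, monoid.mult = (*), one = 1, ring.zero = 0, add = (+) \<rparr>"

text \<open>The zero algebra is allowed: rings of HOL-Algebra need not satisfy \<open>\<one> \<noteq> \<zero>\<close>.\<close>

locale unital_star_algebra = Module.module complex_ring A + ring A
  for A :: "'a top_star_algebra" (structure) +
  assumes smult_mult_left:
      "x \<in> carrier A \<Longrightarrow> y \<in> carrier A \<Longrightarrow> (c \<odot>\<^bsub>A\<^esub> x) \<otimes>\<^bsub>A\<^esub> y = c \<odot>\<^bsub>A\<^esub> (x \<otimes>\<^bsub>A\<^esub> y)"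
    and smult_mult_right:
      "x \<in> carrier A \<Longrightarrow> y \<in> carrier A \<Longrightarrow> x \<otimes>\<^bsub>A\<^esub> (c \<odot>\<^bsub>A\<^esub> y) = c \<odot>\<^bsub>A\<^esub> (x \<otimes>\<^bsub>A\<^esub> y)"
    and star_closed: "x \<in> carrier A \<Longrightarrow> star A x \<in> carrier A"
    and star_star: "x \<in> carrier A \<Longrightarrow> star A (star A x) = x"
    and star_add:
      "x \<in> carrier A \<Longrightarrow> y \<in> carrier A \<Longrightarrow> star A (x \<oplus>\<^bsub>A\<^esub> y) = star A x \<oplus>\<^bsub>A\<^esub> star A y"
    and star_smult:
      "x \<in> carrier A \<Longrightarrow> star A (c \<odot>\<^bsub>A\<^esub> x) = cnj c \<odot>\<^bsub>A\<^esub> star A x"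
    and star_mult:
      "x \<in> carrier A \<Longrightarrow> y \<in> carrier A \<Longrightarrow> star A (x \<otimes>\<^bsub>A\<^esub> y) = star A y \<otimes>\<^bsub>A\<^esub> star A x"

locale unital_topological_star_algebra = unital_star_algebra A
  for A :: "'a top_star_algebra" (structure) +
  assumes topspace_alg_topology: "topspace (alg_topology A) = carrier A"
    and continuous_add:
      "continuous_map (prod_topology (alg_topology A) (alg_topology A)) (alg_topology A)
         (\<lambda>(x, y). x \<oplus>\<^bsub>A\<^esub> y)"
    and continuous_smult:
      "continuous_map (prod_topology (euclidean :: complex topology) (alg_topology A))
         (alg_topology A) (\<lambda>(c, x). c \<odot>\<^bsub>A\<^esub> x)"
    and continuous_mult:
      "continuous_map (prod_topology (alg_topology A) (alg_topology A)) (alg_topology A)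
         (\<lambda>(x, y). x \<otimes>\<^bsub>A\<^esub> y)"
    and continuous_star: "continuous_map (alg_topology A) (alg_topology A) (star A)"

definition cstar_seminorm :: "'a top_star_algebra \<Rightarrow> ('a \<Rightarrow> real) \<Rightarrow> bool" where
  "cstar_seminorm A p \<longleftrightarrow>
     (\<forall>x\<in>carrier A. 0 \<le> p x) \<and>
     (\<forall>x\<in>carrier A. \<forall>y\<in>carrier A. p (x \<oplus>\<^bsub>A\<^esub> y) \<le> p x + p y) \<and>
     (\<forall>c. \<forall>x\<in>carrier A. p (c \<odot>\<^bsub>A\<^esub> x) = cmod c * p x) \<and>
     (\<forall>x\<in>carrier A. \<forall>y\<in>carrier A. p (x \<otimes>\<^bsub>A\<^esub> y) \<le> p x * p y) \<and>
     (\<forall>x\<in>carrier A. p (star A x \<otimes>\<^bsub>A\<^esub> x) = (p x)\<^sup>2)"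

definition continuous_cstar_seminorms :: "'a top_star_algebra \<Rightarrow> ('a \<Rightarrow> real) set" where
  "continuous_cstar_seminorms A =
     {p. cstar_seminorm A p \<and> continuous_map (alg_topology A) euclideanreal p}"

text \<open>The next two notions refer to the translation-invariant uniformity of the additive
  group of \<open>A\<close>; completeness is expressed through filters on the carrier.\<close>

definition cauchy_filter_on :: "'a top_star_algebra \<Rightarrow> 'a filter \<Rightarrow> bool" where
  "cauchy_filter_on A F \<longleftrightarrow>
     F \<noteq> bot \<and> F \<le> principal (carrier A) \<and>
     (\<forall>U. openin (alg_topology A) U \<and> \<zero>\<^bsub>A\<^esub> \<in> U \<longrightarrow>
        (\<exists>B\<subseteq>carrier A. eventually (\<lambda>x. x \<in> B) F \<and> (\<forall>x\<in>B. \<forall>y\<in>B. x \<ominus>\<^bsub>A\<^esub> y \<in> U)))"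

definition complete_top_star_algebra :: "'a top_star_algebra \<Rightarrow> bool" where
  "complete_top_star_algebra A \<longleftrightarrow>
     (\<forall>F. cauchy_filter_on A F \<longrightarrow> (\<exists>l. limitin (alg_topology A) (\<lambda>x. x) l F))"

locale unital_pro_cstar_algebra = unital_topological_star_algebra A
  for A :: "'a top_star_algebra" (structure) +
  assumes hausdorff: "Hausdorff_space (alg_topology A)"
    and complete: "complete_top_star_algebra A"
    and topology_generated:
      "alg_topology A = topology_generated_by
         {{y \<in> carrier A. p (y \<ominus>\<^bsub>A\<^esub> x) < e} | p x e.
            p \<in> continuous_cstar_seminorms A \<and> x \<in> carrier A \<and> 0 < e}"

locale unital_commutative_pro_cstar_algebra = unital_pro_cstar_algebra A + cring A
  for A :: "'a top_star_algebra" (structure)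

definition top_star_algebra_isomorphic ::
    "'a top_star_algebra \<Rightarrow> 'b top_star_algebra \<Rightarrow> bool" where
  "top_star_algebra_isomorphic A B \<longleftrightarrow>
     (\<exists>h \<in> ring_iso A B.
        (\<forall>c. \<forall>x\<in>carrier A. h (c \<odot>\<^bsub>A\<^esub> x) = c \<odot>\<^bsub>B\<^esub> h x) \<and>
        (\<forall>x\<in>carrier A. h (star A x) = star B (h x)) \<and>
        homeomorphic_map (alg_topology A) (alg_topology B) h)"

definition absolutely_convex_in :: "'a top_star_algebra \<Rightarrow> 'a set \<Rightarrow> bool" where
  "absolutely_convex_in A B \<longleftrightarrow>
     (\<forall>x\<in>B. \<forall>y\<in>B. \<forall>a b. cmod a + cmod b \<le> 1 \<longrightarrow> a \<odot>\<^bsub>A\<^esub> x \<oplus>\<^bsub>A\<^esub> b \<odot>\<^bsub>A\<^esub> y \<in> B)"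

definition absorbing_in :: "'a top_star_algebra \<Rightarrow> 'a set \<Rightarrow> bool" where
  "absorbing_in A B \<longleftrightarrow>
     (\<forall>x\<in>carrier A. \<exists>r>0. \<forall>c. cmod c \<le> r \<longrightarrow> c \<odot>\<^bsub>A\<^esub> x \<in> B)"

definition barrel_in :: "'a top_star_algebra \<Rightarrow> 'a set \<Rightarrow> bool" where
  "barrel_in A B \<longleftrightarrow>
     B \<subseteq> carrier A \<and> absolutely_convex_in A B \<and> absorbing_in A B \<and>
     closedin (alg_topology A) B"

definition barreled :: "'a top_star_algebra \<Rightarrow> bool" where
  "barreled A \<longleftrightarrow> (\<forall>B. barrel_in A B \<longrightarrow> \<zero>\<^bsub>A\<^esub> \<in> alg_topology A interior_of B)"

definition tychonoff_space :: "'a topology \<Rightarrow> bool" where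
  "tychonoff_space X \<longleftrightarrow> t1_space X \<and> completely_regular_space X"

definition functionally_Hausdorff_space :: "'a topology \<Rightarrow> bool" where
  "functionally_Hausdorff_space X \<longleftrightarrow>
     (\<forall>x\<in>topspace X. \<forall>y\<in>topspace X. x \<noteq> y \<longrightarrow>
        (\<exists>f. continuous_map X euclideanreal f \<and> f x \<noteq> f y))"

definition relatively_compact_in :: "'a topology \<Rightarrow> 'a set \<Rightarrow> bool" where
  "relatively_compact_in X A \<longleftrightarrow> A \<subseteq> topspace X \<and> compactin X (X closure_of A)"

definition relatively_pseudocompact_in :: "'a topology \<Rightarrow> 'a set \<Rightarrow> bool" where
  "relatively_pseudocompact_in X A \<longleftrightarrow>
     A \<subseteq> topspace X \<and> (\<forall>f. continuous_map X euclideanreal f \<longrightarrow> bounded (f ` A))"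

definition pseudocompacts_relatively_compact :: "'a topology \<Rightarrow> bool" where
  "pseudocompacts_relatively_compact X \<longleftrightarrow>
     (\<forall>A. relatively_pseudocompact_in X A \<longrightarrow> relatively_compact_in X A)"

text \<open>Functions on a space are represented by functions that are \<open>undefined\<close> outside it, so
  that equality in the carrier is equality of functions on \<open>topspace X\<close>.\<close>

definition cfun_carrier :: "'x topology \<Rightarrow> ('x \<Rightarrow> complex) set" where
  "cfun_carrier X = {f \<in> extensional (topspace X). continuous_map X euclidean f}"

definition compact_open_topology :: "'x topology \<Rightarrow> ('x \<Rightarrow> complex) topology" where
  "compact_open_topology X = topology_generated_by
     {{g \<in> cfun_carrier X. \<forall>x\<in>K. cmod (g x - f x) < e} | f K e.
        f \<in> cfun_carrier X \<and> compactin X K \<and> 0 < e}"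

definition cfun_algebra :: "'x topology \<Rightarrow> ('x \<Rightarrow> complex) top_star_algebra" where
  "cfun_algebra X =
     \<lparr> carrier = cfun_carrier X,
       monoid.mult = (\<lambda>f g. \<lambda>x\<in>topspace X. f x * g x),
       one = (\<lambda>x\<in>topspace X. 1),
       ring.zero = (\<lambda>x\<in>topspace X. 0),
       add = (\<lambda>f g. \<lambda>x\<in>topspace X. f x + g x),
       module.smult = (\<lambda>c f. \<lambda>x\<in>topspace X. c * f x),
       star = (\<lambda>f. \<lambda>x\<in>topspace X. cnj (f x)),
       alg_topology = compact_open_topology X \<rparr>"

text \<open>The concrete description of the Tychonoff reflection, to be used for functionally
  Hausdorff \<open>X\<close> only; the universal property is verified below.\<close>

definition tychonoff_reflection :: "'a topology \<Rightarrow> 'a topology" where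
  "tychonoff_reflection X = topology_generated_by
     {{x \<in> topspace X. f x \<in> U} | f U. continuous_map X euclideanreal f \<and> open U}"

lemma topspace_tychonoff_reflection [simp]:
  "topspace (tychonoff_reflection X) = topspace X"
proof -
  have "topspace X \<in> {{x \<in> topspace X. f x \<in> U} | f U.
          continuous_map X euclideanreal f \<and> open (U :: real set)}"
    by (rule CollectI, rule exI[of _ "\<lambda>_. 0"], rule exI[of _ UNIV]) auto
  then show ?thesis
    unfolding tychonoff_reflection_def topology_generated_by_topspace by blast
qed

lemma openin_tychonoff_reflection_vimage:
  assumes "continuous_map X euclideanreal f" "open U"
  shows "openin (tychonoff_reflection X) {x \<in> topspace X. f x \<in> U}"
  unfolding tychonoff_reflection_def
  by (rule topology_generated_by_Basis) (use assms in blast)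

lemma continuous_map_into_tychonoff_reflection:
  "continuous_map X (tychonoff_reflection X) (\<lambda>x. x)"
  unfolding tychonoff_reflection_def
proof (rule continuous_on_generated_topo)
  fix V assume "V \<in> {{x \<in> topspace X. f x \<in> U} | f U.
      continuous_map X euclideanreal f \<and> open (U :: real set)}"
  then obtain f and U :: "real set"
    where V: "V = {x \<in> topspace X. f x \<in> U}" and f: "continuous_map X euclideanreal f" "open U"
    by blast
  have "openin X {x \<in> topspace X. f x \<in> U}"
    by (rule openin_continuous_map_preimage[OF f(1)]) (use f in simp)
  moreover have "(\<lambda>x. x) -` V \<inter> topspace X = V"
    using V by auto
  ultimately show "openin X ((\<lambda>x. x) -` V \<inter> topspace X)"
    using V by simp
next
  show "(\<lambda>x. x) ` topspace X \<subseteq> \<Union> {{x \<in> topspace X. f x \<in> U} | f U.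
      continuous_map X euclideanreal f \<and> open (U :: real set)}"
    using topspace_tychonoff_reflection[of X]
    unfolding tychonoff_reflection_def topology_generated_by_topspace by auto
qed

lemma continuous_map_real_tychonoff_reflection:
  assumes "continuous_map X euclideanreal f"
  shows "continuous_map (tychonoff_reflection X) euclideanreal f"
  unfolding continuous_map_def
  using openin_tychonoff_reflection_vimage[OF assms] by auto

lemma tychonoff_reflection_separates:
  assumes "openin (tychonoff_reflection X) W" "x \<in> W"
  shows "\<exists>g. continuous_map X (top_of_set {0..1::real}) g \<and> g x = 0 \<and>
           (\<forall>z \<in> topspace X - W. g z = 1)"
proof -
  have "generate_topology_on {{x \<in> topspace X. f x \<in> U} | f U.
      continuous_map X euclideanreal f \<and> open (U :: real set)} W"
    using assms(1) unfolding tychonoff_reflection_def openin_topology_generated_by_iff .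
  then show ?thesis
    using assms(2)
  proof (induction arbitrary: x)
    case Empty
    then show ?case by simp
  next
    case (Int a b)
    obtain g where g: "continuous_map X (top_of_set {0..1::real}) g" "g x = 0"
        "\<forall>z \<in> topspace X - a. g z = 1"
      using Int by blast
    obtain h where h: "continuous_map X (top_of_set {0..1::real}) h" "h x = 0"
        "\<forall>z \<in> topspace X - b. h z = 1"
      using Int by blast
    have "continuous_map X (top_of_set {0..1::real}) (\<lambda>z. max (g z) (h z))"
      using g(1) h(1) by (auto simp: continuous_map_in_subtopology Pi_iff le_max_iff_disj
          intro!: continuous_map_real_max)
    moreover have "\<forall>z \<in> topspace X - a \<inter> b. max (g z) (h z) = 1"
    proof
      fix z assume z: "z \<in> topspace X - a \<inter> b"
      have "g z \<le> 1" "h z \<le> 1"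
        using g(1) h(1) z by (auto simp: continuous_map_in_subtopology Pi_iff)
      then show "max (g z) (h z) = 1"
        using g(3) h(3) z by (cases "z \<in> a") auto
    qed
    ultimately show ?case
      using g(2) h(2) by (intro exI[of _ "\<lambda>z. max (g z) (h z)"]) auto
  next
    case (UN K)
    then obtain k where k: "k \<in> K" "x \<in> k" by blast
    obtain g where g: "continuous_map X (top_of_set {0..1::real}) g" "g x = 0"
        "\<forall>z \<in> topspace X - k. g z = 1"
      using UN.IH[OF k] by blast
    have "\<forall>z \<in> topspace X - \<Union> K. g z = 1"
      using g(3) k(1) by auto
    with g(1,2) show ?case by (intro exI[of _ g] conjI)
  next
    case (Basis s)
    then obtain f and U :: "real set"
      where s: "s = {x \<in> topspace X. f x \<in> U}" and f: "continuous_map X euclideanreal f" "open U"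
      by blast
    have "f x \<in> U" using Basis s by simp
    then obtain e where e: "e > 0" "ball (f x) e \<subseteq> U"
      using f(2) openE by blast
    let ?g = "\<lambda>z. min 1 (\<bar>f z - f x\<bar> / e)"
    have "continuous_map X (top_of_set {0..1}) ?g"
      using f(1) e(1) by (auto simp: continuous_map_in_subtopology
          intro!: continuous_map_real_min continuous_map_real_divide continuous_map_real_abs
            continuous_map_diff)
    moreover have "\<forall>z \<in> topspace X - s. ?g z = 1"
    proof
      fix z assume "z \<in> topspace X - s"
      then have "f z \<notin> ball (f x) e" using e s by auto
      then have "e \<le> \<bar>f z - f x\<bar>" by (simp add: dist_real_def abs_minus_commute)
      then show "?g z = 1" using e(1) by (simp add: min_def field_simps)
    qed
    ultimately show ?case by (intro exI[of _ ?g]) auto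
  qed
qed

lemma tychonoff_space_tychonoff_reflection:
  assumes "functionally_Hausdorff_space X"
  shows "tychonoff_space (tychonoff_reflection X)"
  unfolding tychonoff_space_def
proof
  show "completely_regular_space (tychonoff_reflection X)"
    unfolding completely_regular_space_def
  proof (intro allI impI)
    fix S x
    assume S: "closedin (tychonoff_reflection X) S \<and> x \<in> topspace (tychonoff_reflection X) - S"
    then have "openin (tychonoff_reflection X) (topspace X - S)" "x \<in> topspace X - S"
      by (auto simp: closedin_def)
    then obtain g where g: "continuous_map X (top_of_set {0..1::real}) g" "g x = 0"
        "\<forall>z \<in> topspace X - (topspace X - S). g z = 1"
      using tychonoff_reflection_separates[of X "topspace X - S" x] by auto
    have "S \<subseteq> topspace X" using S closedin_subset by fastforce
    moreover have "continuous_map (tychonoff_reflection X) (top_of_set {0..1::real}) g"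
      using g(1) by (auto simp: continuous_map_in_subtopology
          intro: continuous_map_real_tychonoff_reflection)
    ultimately show "\<exists>f. continuous_map (tychonoff_reflection X) (top_of_set {0..1::real}) f \<and>
        f x = 0 \<and> f ` S \<subseteq> {1}"
      using g(2,3) by blast
  qed
  have "Hausdorff_space (tychonoff_reflection X)"
    unfolding Hausdorff_space_def
  proof (intro allI impI)
    fix x y
    assume xy: "x \<in> topspace (tychonoff_reflection X) \<and>
      y \<in> topspace (tychonoff_reflection X) \<and> x \<noteq> y"
    then obtain f where f: "continuous_map X euclideanreal f" "f x \<noteq> f y"
      using assms unfolding functionally_Hausdorff_space_def by auto
    obtain U V where UV: "open U" "open V" "f x \<in> U" "f y \<in> V" "U \<inter> V = {}"
      using hausdorff[OF f(2)] by blast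
    have "disjnt {z \<in> topspace X. f z \<in> U} {z \<in> topspace X. f z \<in> V}"
      using UV by (auto simp: disjnt_def)
    then show "\<exists>U V. openin (tychonoff_reflection X) U \<and> openin (tychonoff_reflection X) V \<and>
        x \<in> U \<and> y \<in> V \<and> disjnt U V"
      using openin_tychonoff_reflection_vimage[OF f(1) UV(1)]
        openin_tychonoff_reflection_vimage[OF f(1) UV(2)] UV xy
      by (intro exI conjI) auto
  qed
  then show "t1_space (tychonoff_reflection X)"
    by (rule Hausdorff_imp_t1_space)
qed

lemma tychonoff_reflection_universal:
  assumes "tychonoff_space Y" and f: "continuous_map X Y f"
  shows "continuous_map (tychonoff_reflection X) Y f"
  unfolding continuous_map_def
proof (intro conjI allI impI)
  show "f \<in> topspace (tychonoff_reflection X) \<rightarrow> topspace Y"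
    using f by (simp add: continuous_map_def)
  fix V assume V: "openin Y V"
  show "openin (tychonoff_reflection X) {x \<in> topspace (tychonoff_reflection X). f x \<in> V}"
  proof (subst openin_subopen, intro ballI)
    fix x assume "x \<in> {x \<in> topspace (tychonoff_reflection X). f x \<in> V}"
    then have x: "x \<in> topspace X" "f x \<in> V" by auto
    have "closedin Y (topspace Y - V)" "f x \<in> topspace Y - (topspace Y - V)"
      using V x openin_subset by fastforce+
    then obtain g where g: "continuous_map Y (top_of_set {0..1::real}) g" "g (f x) = 0"
        "g ` (topspace Y - V) \<subseteq> {1}"
      using assms(1) unfolding tychonoff_space_def completely_regular_space_def by meson
    have "continuous_map X euclideanreal (g \<circ> f)"
      using f g(1) continuous_map_compose by (fastforce simp: continuous_map_in_subtopology)
    then have "openin (tychonoff_reflection X) {z \<in> topspace X. (g \<circ> f) z \<in> {..<1}}"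
      by (rule openin_tychonoff_reflection_vimage) simp
    moreover have "{z \<in> topspace X. (g \<circ> f) z \<in> {..<1}} \<subseteq>
        {x \<in> topspace (tychonoff_reflection X). f x \<in> V}"
      using f g(3) by (fastforce simp: continuous_map_def Pi_iff)
    ultimately show "\<exists>T. openin (tychonoff_reflection X) T \<and> x \<in> T \<and>
        T \<subseteq> {x \<in> topspace (tychonoff_reflection X). f x \<in> V}"
      using x g(2) by (intro exI conjI) auto
  qed
qed

end

theory Submission
  imports Defs
begin

text \<open>Barreled \<open>A\<close>: let \<open>X\<close> be the set of continuous characters with the weak topology. The compact
  sets of characters bounded by a continuous \<open>C\<^sup>*\<close>-seminorm cover \<open>X\<close>, and each such seminorm is the
  supremum over its set, so Stone-Weierstrass and completeness identify \<open>A\<close> with \<open>C(X)\<close> as an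
  algebra. The polar of a relatively pseudocompact set \<open>S\<close> of characters is a barrel, so \<open>S\<close> lies in
  one of these compact sets; hence the topology is the compact-open one. To find a character with
  \<open>\<bar>\<phi> a\<bar> = p a\<close> without completing \<open>A\<close>, take a minimal \<open>C\<^sup>*\<close>-seminorm below \<open>p\<close> that is
  concentrated where \<open>\<bar>a\<bar>\<close> is maximal. It is multiplicative, so it is the absolute value of a
  character by Ostrowski's form of the Gelfand-Mazur theorem.

  Conversely (Nachbin-Shirota), a barrel in \<open>C(X)\<close> has a closed support \<open>K\<close>, outside of which functions
  can be altered freely. The barrel contains a uniform ball, and \<open>K\<close> is relatively pseudocompact; both
  follow from Baire's theorem in the space of bounded sequences, applied to the coefficients of
  locally dominated series. So \<open>K\<close> is compact and the barrel is a neighbourhood of zero.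

  For the second part, a compact subset of \<open>\<tau>X\<close> is relatively pseudocompact in \<open>X\<close>.\<close>

section \<open>Compact sets in the Tychonoff reflection\<close>

text \<open>The textbook route completes each quotient by the kernel of a seminorm and applies
  Gelfand theory to the resulting Banach algebras. Multiplicative seminorms on the carrier itself
  replace this: Ostrowski's argument only needs minima over a compact disc of the complex plane. The
  Gelfand map is an open bijection onto C(X) for every commutative pro-C*-algebra. Its continuity is
  the obstacle, since a compact set of characters need not lie below a single continuous seminorm.
  Barreledness supplies this, and supplies it for all relatively pseudocompact sets, which also
  gives the condition on X. In the converse neither X nor C(X) need be a Baire space, so Baire's
  theorem is moved to a space of parameters. Local domination is what allows the terms of a series
  to be multiplied by an arbitrary bounded sequence while the sum stays continuous. The two
  applications differ in the source of the domination: geometric decay for the uniform ball, local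
  finiteness for the support.\<close>

lemma compactin_imp_relatively_pseudocompact:
  assumes "compactin X K"
  shows "relatively_pseudocompact_in X K"
  unfolding relatively_pseudocompact_in_def
proof (intro conjI allI impI)
  show "K \<subseteq> topspace X" using assms by (rule compactin_subset_topspace)
  fix f assume "continuous_map X euclideanreal f"
  then show "bounded (f ` K)"
    using image_compactin[OF assms] compact_imp_bounded by (metis compactin_euclidean_iff)
qed

lemma tychonoff_imp_Hausdorff_space: "tychonoff_space X \<Longrightarrow> Hausdorff_space X"
  unfolding tychonoff_space_def
  using completely_regular_imp_regular_space regular_t1_imp_Hausdorff_space by blast

text \<open>\<open>X\<close> and its reflection have the same continuous real functions, so a
  compact set of the reflection is relatively pseudocompact in \<open>X\<close>. It is closed in the
  Hausdorff reflection, hence in the finer topology of \<open>X\<close>, and so equals its own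
  compact closure.\<close>

lemma compactin_tychonoff_reflection_iff:
  assumes X: "functionally_Hausdorff_space X" "pseudocompacts_relatively_compact X"
  shows "compactin (tychonoff_reflection X) K \<longleftrightarrow> compactin X K"
proof
  assume "compactin X K"
  then show "compactin (tychonoff_reflection X) K"
    using image_compactin[OF _ continuous_map_into_tychonoff_reflection, of X K] by simp
next
  assume K: "compactin (tychonoff_reflection X) K"
  then have "relatively_pseudocompact_in X K"
    using compactin_imp_relatively_pseudocompact[OF K] continuous_map_real_tychonoff_reflection
    unfolding relatively_pseudocompact_in_def topspace_tychonoff_reflection by blast
  then have "compactin X (X closure_of K)" "K \<subseteq> topspace X"
    using X(2) unfolding pseudocompacts_relatively_compact_def relatively_compact_in_def by auto
  moreover have "closedin X K"
  proof -
    have "closedin (tychonoff_reflection X) K"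
      using tychonoff_space_tychonoff_reflection[OF X(1)] K
      by (intro compactin_imp_closedin tychonoff_imp_Hausdorff_space)
    then have "closedin X {x \<in> topspace X. x \<in> K}"
      by (rule closedin_continuous_map_preimage[OF continuous_map_into_tychonoff_reflection])
    moreover have "{x \<in> topspace X. x \<in> K} = K" using \<open>K \<subseteq> topspace X\<close> by blast
    ultimately show ?thesis by simp
  qed
  ultimately show "compactin X K"
    by (simp add: closure_of_closedin)
qed

text \<open>The identity is a continuous bijection from a compact space to a Hausdorff space. This
  makes the compact sets agree as subspaces and not only as sets.\<close>

lemma subtopology_tychonoff_reflection_compact:
  assumes X: "functionally_Hausdorff_space X" and K: "compactin X K"
  shows "subtopology (tychonoff_reflection X) K = subtopology X K"
proof -
  have "Hausdorff_space (tychonoff_reflection X)"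
    using tychonoff_space_tychonoff_reflection[OF X] by (rule tychonoff_imp_Hausdorff_space)
  moreover have "continuous_map (subtopology X K) (subtopology (tychonoff_reflection X) K) id"
    using continuous_map_into_tychonoff_reflection[of X]
    by (auto simp: continuous_map_in_subtopology id_def intro: continuous_map_from_subtopology)
  ultimately have "homeomorphic_map (subtopology X K) (subtopology (tychonoff_reflection X) K) id"
    using K by (intro continuous_imp_homeomorphic_map)
      (auto simp: compact_space_subtopology Hausdorff_space_subtopology)
  then show ?thesis by simp
qed

section \<open>Characters of commutative star algebras\<close>

text \<open>Purely algebraic: characters are produced from one C*-seminorm at a time, before any
  topology on \<open>A\<close> enters.\<close>

locale commutative_star_algebra = unital_star_algebra A + cring A
  for A :: "'a top_star_algebra" (structure)
begin

lemma smult_in_carrier [simp, intro]: "x \<in> carrier A \<Longrightarrow> c \<odot> x \<in> carrier A"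
  using smult_closed[of c x] by (simp add: complex_ring_def)

lemma smult_add_left: "x \<in> carrier A \<Longrightarrow> (a + b) \<odot> x = a \<odot> x \<oplus> b \<odot> x"
  using smult_l_distr[of a b x] by (simp add: complex_ring_def)

lemma smult_smult: "x \<in> carrier A \<Longrightarrow> a \<odot> (b \<odot> x) = (a * b) \<odot> x"
  using smult_assoc1[of a b x] by (simp add: complex_ring_def)

lemma one_smult [simp]: "x \<in> carrier A \<Longrightarrow> 1 \<odot> x = x"
  using smult_one[of x] by (simp add: complex_ring_def)

lemma zero_smult [simp]: "x \<in> carrier A \<Longrightarrow> 0 \<odot> x = \<zero>"
  using smult_l_null[of x] by (simp add: complex_ring_def)

lemma minus_smult: "x \<in> carrier A \<Longrightarrow> (- c) \<odot> x = \<ominus> (c \<odot> x)"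
  using smult_add_left[of x c "- c"]
  by (metis add.right_inverse minus_equality smult_in_carrier zero_smult a_comm)

lemma star_in_carrier [simp, intro]: "x \<in> carrier A \<Longrightarrow> star A x \<in> carrier A"
  by (rule star_closed)

lemma star_one [simp]: "star A \<one> = \<one>"
proof -
  have "\<one> = star A (star A \<one> \<otimes> \<one>)"
    by (simp add: star_star)
  also have "\<dots> = star A \<one>"
    by (subst star_mult) (auto simp: star_star)
  finally show ?thesis by simp
qed

lemma star_minus: "x \<in> carrier A \<Longrightarrow> star A (\<ominus> x) = \<ominus> (star A x)"
  using star_smult[of x "- 1"] by (simp add: minus_smult)

lemma star_pow: "x \<in> carrier A \<Longrightarrow> star A (x [^] (n::nat)) = star A x [^] n"
  by (induction n) (auto simp: star_mult m_comm)

abbreviation scalar :: "complex \<Rightarrow> 'a" where "scalar z \<equiv> z \<odot> \<one>"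

lemma scalar_add: "scalar (a + b) = scalar a \<oplus> scalar b"
  by (simp add: smult_add_left)

lemma scalar_mult: "scalar (a * b) = scalar a \<otimes> scalar b"
  by (simp add: smult_mult_left smult_smult)

lemma scalar_uminus: "scalar (- a) = \<ominus> scalar a"
  by (simp add: minus_smult)

lemma scalar_diff: "scalar (a - b) = scalar a \<ominus> scalar b"
  using scalar_add[of a "- b"] by (simp add: scalar_uminus a_minus_def)

lemma smult_eq_scalar_mult: "x \<in> carrier A \<Longrightarrow> c \<odot> x = scalar c \<otimes> x"
  by (simp add: smult_mult_left)

section \<open>Elementary properties of C*-seminorms\<close>

context
  fixes p assumes p: "cstar_seminorm A p"
begin

lemma seminorm_nonneg: "x \<in> carrier A \<Longrightarrow> 0 \<le> p x"
  and seminorm_add: "x \<in> carrier A \<Longrightarrow> y \<in> carrier A \<Longrightarrow> p (x \<oplus> y) \<le> p x + p y"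
  and seminorm_smult: "x \<in> carrier A \<Longrightarrow> p (c \<odot> x) = cmod c * p x"
  and seminorm_mult: "x \<in> carrier A \<Longrightarrow> y \<in> carrier A \<Longrightarrow> p (x \<otimes> y) \<le> p x * p y"
  and seminorm_star_mult: "x \<in> carrier A \<Longrightarrow> p (star A x \<otimes> x) = (p x)\<^sup>2"
  using p unfolding cstar_seminorm_def by auto

lemma seminorm_zero: "p \<zero> = 0"
  using seminorm_smult[of \<zero> 0] by simp

lemma seminorm_minus: "x \<in> carrier A \<Longrightarrow> p (\<ominus> x) = p x"
  using seminorm_smult[of x "- 1"] by (simp add: minus_smult)

lemma seminorm_diff: "x \<in> carrier A \<Longrightarrow> y \<in> carrier A \<Longrightarrow> p (x \<ominus> y) \<le> p x + p y"
  using seminorm_add[of x "\<ominus> y"] by (simp add: seminorm_minus a_minus_def)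

lemma seminorm_diff_commute:
  "x \<in> carrier A \<Longrightarrow> y \<in> carrier A \<Longrightarrow> p (x \<ominus> y) = p (y \<ominus> x)"
  using seminorm_minus[of "x \<ominus> y"] by (simp add: minus_add a_minus_def a_comm)

lemma seminorm_diff_triangle:
  assumes "x \<in> carrier A" "y \<in> carrier A" "z \<in> carrier A"
  shows "p (x \<ominus> z) \<le> p (x \<ominus> y) + p (y \<ominus> z)"
proof -
  have "x \<ominus> z = (x \<ominus> y) \<oplus> (y \<ominus> z)"
    using assms by algebra
  then show ?thesis
    using seminorm_add[of "x \<ominus> y" "y \<ominus> z"] assms by simp
qed

lemma seminorm_le_add_diff:
  assumes "x \<in> carrier A" "y \<in> carrier A"
  shows "p x \<le> p y + p (x \<ominus> y)"
proof -
  have "x = y \<oplus> (x \<ominus> y)"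
    using assms by algebra
  then show ?thesis
    using seminorm_add[of y "x \<ominus> y"] assms by simp
qed

text \<open>The C*-identity and submultiplicativity give \<open>p y \<le> p (star A y)\<close>; the
  same inequality for \<open>star A y\<close> is the converse.\<close>

lemma seminorm_star:
  assumes x: "x \<in> carrier A"
  shows "p (star A x) = p x"
proof -
  have le: "p y \<le> p (star A y)" if y: "y \<in> carrier A" for y
  proof (cases "p y = 0")
    case True
    then show ?thesis using y by (simp add: seminorm_nonneg)
  next
    case False
    have "p y * p y \<le> p (star A y) * p y"
      using seminorm_star_mult[OF y] seminorm_mult[of "star A y" y] y
      by (simp add: power2_eq_square)
    then show ?thesis
      using False seminorm_nonneg[OF y] by simp
  qed
  show ?thesis
    using le[OF x] le[of "star A x"] x by (simp add: star_star)
qed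

lemma seminorm_one: "p \<one> = 0 \<or> p \<one> = 1"
  using seminorm_star_mult[of \<one>] by (auto simp: power2_eq_square)

end

text \<open>Makes the continuous C*-seminorms a directed family, on which the neighbourhood bases
  and the Cauchy filter built later depend.\<close>

lemma cstar_seminorm_max:
  assumes p: "cstar_seminorm A p" and q: "cstar_seminorm A q"
  shows "cstar_seminorm A (\<lambda>x. max (p x) (q x))"
  unfolding cstar_seminorm_def
proof (intro conjI ballI allI)
  fix x y c assume x: "x \<in> carrier A" and y: "y \<in> carrier A"
  note nn = seminorm_nonneg[OF p x] seminorm_nonneg[OF q x]
    seminorm_nonneg[OF p y] seminorm_nonneg[OF q y]
  show "0 \<le> max (p x) (q x)" using nn by simp
  show "max (p (x \<oplus> y)) (q (x \<oplus> y)) \<le> max (p x) (q x) + max (p y) (q y)"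
    using seminorm_add[OF p x y] seminorm_add[OF q x y] by linarith
  show "max (p (c \<odot> x)) (q (c \<odot> x)) = cmod c * max (p x) (q x)"
    by (simp add: seminorm_smult[OF p x] seminorm_smult[OF q x] max_mult_distrib_left)
  have "p x * p y \<le> max (p x) (q x) * max (p y) (q y)"
    "q x * q y \<le> max (p x) (q x) * max (p y) (q y)"
    using nn by (auto intro!: mult_mono)
  then show "max (p (x \<otimes> y)) (q (x \<otimes> y)) \<le> max (p x) (q x) * max (p y) (q y)"
    using seminorm_mult[OF p x y] seminorm_mult[OF q x y] by linarith
  show "max (p (star A x \<otimes> x)) (q (star A x \<otimes> x)) = (max (p x) (q x))\<^sup>2"
    using nn by (auto simp: seminorm_star_mult[OF p x] seminorm_star_mult[OF q x] max_def)
qed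

text \<open>For \<open>q\<close> the supremum norm over a compact set of characters and \<open>b\<close> self-adjoint, the limit
  is the supremum norm over the characters at which \<open>\<bar>b\<bar>\<close> is maximal.\<close>

definition peak_seminorm :: "('a \<Rightarrow> real) \<Rightarrow> 'a \<Rightarrow> 'a \<Rightarrow> real" where
  "peak_seminorm q b x = (if x \<in> carrier A then lim (\<lambda>n. q (x \<otimes> b [^] n) / q b ^ n) else 0)"

context
  fixes q b
  assumes q: "cstar_seminorm A q" and b: "b \<in> carrier A" "star A b = b" "0 < q b"
begin

lemma peak_decseq:
  assumes x: "x \<in> carrier A"
  shows "decseq (\<lambda>n. q (x \<otimes> b [^] n) / q b ^ n)"
proof (rule decseq_SucI)
  fix n :: nat
  have "q (x \<otimes> b [^] Suc n) \<le> q (x \<otimes> b [^] n) * q b"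
    using seminorm_mult[OF q, of "x \<otimes> b [^] n" b] x b by (simp add: m_assoc)
  then show "q (x \<otimes> b [^] Suc n) / q b ^ Suc n \<le> q (x \<otimes> b [^] n) / q b ^ n"
    using b(3) by (simp add: field_simps)
qed

lemma peak_tendsto:
  assumes x: "x \<in> carrier A"
  shows "(\<lambda>n. q (x \<otimes> b [^] n) / q b ^ n) \<longlonglongrightarrow> peak_seminorm q b x"
proof -
  have "0 \<le> q (x \<otimes> b [^] n) / q b ^ n" for n :: nat
    using x b seminorm_nonneg[OF q] by simp
  then have "convergent (\<lambda>n. q (x \<otimes> b [^] n) / q b ^ n)"
    using decseq_convergent[OF peak_decseq[OF x], of 0] by (metis convergentI)
  then show ?thesis
    using x by (simp add: peak_seminorm_def convergent_LIMSEQ_iff)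
qed

lemma peak_le_term:
  assumes x: "x \<in> carrier A"
  shows "peak_seminorm q b x \<le> q (x \<otimes> b [^] n) / q b ^ n"
  by (rule decseq_ge[OF peak_decseq[OF x] peak_tendsto[OF x]])

lemma peak_le: "x \<in> carrier A \<Longrightarrow> peak_seminorm q b x \<le> q x"
  using peak_le_term[of x 0] by simp

text \<open>Subadditivity and homogeneity hold term by term. For products and the C*-identity the
  limit is taken along even exponents, where the power of \<open>b\<close> splits into two equal
  self-adjoint factors, one for each factor of the product.\<close>

lemma cstar_seminorm_peak: "cstar_seminorm A (peak_seminorm q b)"
  unfolding cstar_seminorm_def
proof (intro conjI ballI allI)
  fix x y c assume x: "x \<in> carrier A" and y: "y \<in> carrier A"
  let ?s = "\<lambda>x n. q (x \<otimes> b [^] (n::nat)) / q b ^ n"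
  have bn: "b [^] n \<in> carrier A" for n :: nat using b by simp
  show "0 \<le> peak_seminorm q b x"
    by (rule LIMSEQ_le_const[OF peak_tendsto[OF x]])
      (use x b seminorm_nonneg[OF q] in auto)
  have "?s (x \<oplus> y) n \<le> ?s x n + ?s y n" for n
    using seminorm_add[OF q, of "x \<otimes> b [^] n" "y \<otimes> b [^] n"] x y b bn
    by (simp add: l_distr divide_right_mono flip: add_divide_distrib)
  then show "peak_seminorm q b (x \<oplus> y) \<le> peak_seminorm q b x + peak_seminorm q b y"
    by (intro LIMSEQ_le[OF peak_tendsto tendsto_add[OF peak_tendsto peak_tendsto]])
      (use x y in auto)
  have "?s (c \<odot> x) = (\<lambda>n. cmod c * ?s x n)"
    using x bn by (simp add: smult_mult_left seminorm_smult[OF q])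
  then show "peak_seminorm q b (c \<odot> x) = cmod c * peak_seminorm q b x"
    using peak_tendsto[of "c \<odot> x"] tendsto_mult_left[OF peak_tendsto[OF x], of "cmod c"] x
    by (auto intro: LIMSEQ_unique)
  have bnn: "b [^] (n * 2) = b [^] n \<otimes> b [^] n" for n :: nat
    using b nat_pow_mult[of b n n] by (simp add: mult_2_right)
  have sub: "(\<lambda>n. ?s z (n * 2)) \<longlonglongrightarrow> peak_seminorm q b z" if "z \<in> carrier A" for z
    using LIMSEQ_subseq_LIMSEQ[OF peak_tendsto[OF that], of "\<lambda>n. n * 2"]
    by (simp add: strict_mono_def o_def)
  have "?s (x \<otimes> y) (n * 2) \<le> ?s x n * ?s y n" for n
  proof -
    have "(x \<otimes> y) \<otimes> b [^] (n * 2) = (x \<otimes> b [^] n) \<otimes> (y \<otimes> b [^] n)"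
      using x y bn[of n] unfolding bnn by algebra
    then have "q ((x \<otimes> y) \<otimes> b [^] (n * 2)) \<le> q (x \<otimes> b [^] n) * q (y \<otimes> b [^] n)"
      using seminorm_mult[OF q, of "x \<otimes> b [^] n" "y \<otimes> b [^] n"] x y bn by simp
    then show ?thesis
      using b(3) by (simp add: power_mult power2_eq_square divide_right_mono)
  qed
  then show "peak_seminorm q b (x \<otimes> y) \<le> peak_seminorm q b x * peak_seminorm q b y"
    by (intro LIMSEQ_le[OF sub tendsto_mult[OF peak_tendsto peak_tendsto]])
      (use x y in auto)
  have "?s (star A x \<otimes> x) (n * 2) = (?s x n)\<^sup>2" for n
  proof -
    have "(star A x \<otimes> x) \<otimes> b [^] (n * 2) = star A (x \<otimes> b [^] n) \<otimes> (x \<otimes> b [^] n)"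
      using x bn[of n] b star_in_carrier[OF x] unfolding bnn
      by (simp add: star_mult star_pow m_ac)
    then show ?thesis
      using seminorm_star_mult[OF q, of "x \<otimes> b [^] n"] x bn
      by (simp add: power_mult power_divide)
  qed
  then have "(\<lambda>n. (?s x n)\<^sup>2) \<longlonglongrightarrow> peak_seminorm q b (star A x \<otimes> x)"
    using sub[of "star A x \<otimes> x"] x by simp
  then show "peak_seminorm q b (star A x \<otimes> x) = (peak_seminorm q b x)\<^sup>2"
    by (rule LIMSEQ_unique) (intro tendsto_power peak_tendsto x)
qed

text \<open>A shift of the index by one. This is the algebraic trace of concentration: where the
  peak seminorm lives, \<bar>b\<bar> is constantly equal to its maximum \<open>q b\<close>.\<close>

lemma peak_mult_left:
  assumes x: "x \<in> carrier A"
  shows "peak_seminorm q b (b \<otimes> x) = q b * peak_seminorm q b x"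
proof -
  have "q ((b \<otimes> x) \<otimes> b [^] n) / q b ^ n = q b * (q (x \<otimes> b [^] Suc n) / q b ^ Suc n)"
    for n :: nat
  proof -
    have "(b \<otimes> x) \<otimes> b [^] n = x \<otimes> (b [^] n \<otimes> b)"
      using x b nat_pow_closed[of b n] by algebra
    then show ?thesis using b(3) by simp
  qed
  then have "(\<lambda>n. q ((b \<otimes> x) \<otimes> b [^] n) / q b ^ n) \<longlonglongrightarrow> q b * peak_seminorm q b x"
    using tendsto_mult_left[OF LIMSEQ_Suc[OF peak_tendsto[OF x]], of "q b"] by simp
  then show ?thesis
    using LIMSEQ_unique[OF peak_tendsto[of "b \<otimes> x"]] x b by simp
qed

lemma seminorm_selfadjoint_pow: "q (b [^] ((2::nat) ^ k)) = q b ^ (2 ^ k)"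
proof (induction k)
  case (Suc k)
  have "b [^] ((2::nat) ^ Suc k) = star A (b [^] ((2::nat) ^ k)) \<otimes> b [^] ((2::nat) ^ k)"
    using b nat_pow_mult[of b "2 ^ k" "2 ^ k"] by (simp add: star_pow mult_2)
  then show ?case
    using b Suc seminorm_star_mult[OF q, of "b [^] ((2::nat) ^ k)"]
    by (simp add: power_mult[symmetric] mult.commute)
qed (use b in simp)

text \<open>Guards against a limit that vanishes: along the exponents \<open>2 ^ k\<close> every
  term equals 1, by the iterated C*-identity for the self-adjoint \<open>b\<close>.\<close>

lemma peak_one: "peak_seminorm q b \<one> = 1"
proof -
  have "(\<lambda>k. q (\<one> \<otimes> b [^] ((2::nat) ^ k)) / q b ^ (2 ^ k)) \<longlonglongrightarrow> peak_seminorm q b \<one>"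
    using LIMSEQ_subseq_LIMSEQ[OF peak_tendsto[of \<one>], of "\<lambda>k. 2 ^ k"]
    by (simp add: strict_mono_def o_def)
  then have "(\<lambda>k::nat. 1) \<longlonglongrightarrow> peak_seminorm q b \<one>"
    using b by (simp add: seminorm_selfadjoint_pow)
  then show ?thesis by (simp add: LIMSEQ_const_iff)
qed

end

section \<open>Minimal C*-seminorms\<close>

lemma cstar_seminorm_limit:
  assumes F: "F \<noteq> bot" and ev: "eventually (cstar_seminorm A) F"
    and lim: "\<And>x. x \<in> carrier A \<Longrightarrow> ((\<lambda>q. q x) \<longlongrightarrow> u x) F"
  shows "cstar_seminorm A u"
  unfolding cstar_seminorm_def
proof (intro conjI ballI allI)
  fix x y c assume x: "x \<in> carrier A" and y: "y \<in> carrier A"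
  note lims = lim[OF x] lim[OF y] lim[OF a_closed[OF x y]] lim[OF m_closed[OF x y]]
    lim[OF smult_in_carrier[OF x, of c]] lim[OF m_closed[OF star_in_carrier[OF x] x]]
  show "0 \<le> u x"
    by (rule tendsto_lowerbound[OF lims(1) _ F])
      (use ev x in \<open>auto elim!: eventually_mono intro: seminorm_nonneg\<close>)
  show "u (x \<oplus> y) \<le> u x + u y"
    by (rule tendsto_le[OF F tendsto_add[OF lims(1,2)] lims(3)])
      (use ev x y in \<open>auto elim!: eventually_mono intro: seminorm_add\<close>)
  show "u (x \<otimes> y) \<le> u x * u y"
    by (rule tendsto_le[OF F tendsto_mult[OF lims(1,2)] lims(4)])
      (use ev x y in \<open>auto elim!: eventually_mono intro: seminorm_mult\<close>)
  have "((\<lambda>q. cmod c * q x) \<longlongrightarrow> u (c \<odot> x)) F"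
    by (rule Lim_transform_eventually[OF lims(5)])
      (use ev x in \<open>auto elim!: eventually_mono simp: seminorm_smult\<close>)
  then show "u (c \<odot> x) = cmod c * u x"
    using tendsto_unique[OF F] tendsto_mult_left[OF lims(1)] by blast
  have "((\<lambda>q. (q x)\<^sup>2) \<longlongrightarrow> u (star A x \<otimes> x)) F"
    by (rule Lim_transform_eventually[OF lims(6)])
      (use ev x in \<open>auto elim!: eventually_mono simp: seminorm_star_mult\<close>)
  then show "u (star A x \<otimes> x) = (u x)\<^sup>2"
    using tendsto_unique[OF F] tendsto_power[OF lims(1)] by blast
qed

text \<open>The axioms of a C*-seminorm pass to pointwise limits, while sums and products do not
  commute with infima in general. On a chain the infimum is the limit along the filter of lower
  sections, so \<open>cstar_seminorm_limit\<close> applies to it.\<close>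

lemma cstar_seminorm_chain_Inf:
  assumes C: "C \<noteq> {}" and q: "\<And>q. q \<in> C \<Longrightarrow> cstar_seminorm A q"
    and chain: "\<And>q r. q \<in> C \<Longrightarrow> r \<in> C \<Longrightarrow> q \<le> r \<or> r \<le> q"
  obtains F where "F \<noteq> bot" "eventually (\<lambda>q. q \<in> C) F"
    "\<And>x. x \<in> carrier A \<Longrightarrow> ((\<lambda>q. q x) \<longlongrightarrow> (INF q\<in>C. q x)) F"
proof -
  define F where "F = (INF r\<in>C. principal {q \<in> C. q \<le> r})"
  have ev: "eventually P F \<longleftrightarrow> (\<exists>r\<in>C. \<forall>q\<in>C. q \<le> r \<longrightarrow> P q)" for P
    unfolding F_def
  proof (subst eventually_INF_base)
    fix r s assume "r \<in> C" "s \<in> C"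
    then show "\<exists>t\<in>C. principal {q \<in> C. q \<le> t}
        \<le> inf (principal {q \<in> C. q \<le> r}) (principal {q \<in> C. q \<le> s})"
      using chain[of r s] by (auto intro: order_trans)
  qed (use C in \<open>auto simp: eventually_principal\<close>)
  show ?thesis
  proof
    show "F \<noteq> bot"
      using ev[of "\<lambda>_. False"] by (auto simp: eventually_False[symmetric])
    show "eventually (\<lambda>q. q \<in> C) F"
      using C by (auto simp: ev)
    fix x assume x: "x \<in> carrier A"
    have bdd: "bdd_below ((\<lambda>q. q x) ` C)"
      using seminorm_nonneg[OF q x] by (auto intro!: bdd_belowI[of _ 0])
    show "((\<lambda>q. q x) \<longlongrightarrow> (INF q\<in>C. q x)) F"
    proof (rule order_tendstoI)
      fix e assume "e < (INF q\<in>C. q x)"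
      then show "eventually (\<lambda>q. e < q x) F"
        using C cINF_lower[OF bdd] by (force simp: ev)
    next
      fix e assume "(INF q\<in>C. q x) < e"
      then obtain r where "r \<in> C" "r x < e"
        using C bdd by (auto simp: cINF_less_iff)
      then show "eventually (\<lambda>q. q x < e) F"
        by (auto simp: ev le_fun_def intro: le_less_trans)
    qed
  qed
qed

text \<open>The candidates for the absolute value of a character below \<open>p\<close> that attains
  \<open>p b\<close> at \<open>b\<close>. The value 1 at the unit keeps limits of chains nonzero;
  the value 0 off the carrier makes the order and equality of functions depend on the carrier
  alone.\<close>

definition peaked :: "('a \<Rightarrow> real) \<Rightarrow> 'a \<Rightarrow> ('a \<Rightarrow> real) set" where
  "peaked p b = {q. cstar_seminorm A q \<and> q \<one> = 1 \<and> (\<forall>x\<in>carrier A. q x \<le> p x) \<and>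
     (\<forall>x\<in>carrier A. q (b \<otimes> x) = p b * q x) \<and> (\<forall>x. x \<notin> carrier A \<longrightarrow> q x = 0)}"

lemma minimal_peaked:
  assumes p: "cstar_seminorm A p" and b: "b \<in> carrier A" "star A b = b" "0 < p b"
  obtains q where "q \<in> peaked p b" "\<And>r. r \<in> peaked p b \<Longrightarrow> r \<le> q \<Longrightarrow> r = q"
proof -
  have ne: "peak_seminorm p b \<in> peaked p b"
    using cstar_seminorm_peak[OF p b] peak_le[OF p b] peak_mult_left[OF p b] peak_one[OF p b]
    by (auto simp: peaked_def peak_seminorm_def)
  have "\<exists>q\<in>peaked p b. \<forall>r\<in>peaked p b. r \<le> q \<longrightarrow> r = q"
  proof (rule predicate_Zorn)
    \<comment> \<open>Zorn's lemma is used for the reversed order, so a maximal element is a minimal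
      seminorm and an upper bound of a chain is its infimum.\<close>
    show "partial_order_on (peaked p b) (relation_of (\<lambda>q r. r \<le> q) (peaked p b))"
      by (rule partial_order_on_relation_ofI) auto
    fix C assume "C \<in> Chains (relation_of (\<lambda>q r. r \<le> q) (peaked p b))"
    then have CP: "q \<in> peaked p b" and chain: "q \<le> r \<or> r \<le> q" if "q \<in> C" "r \<in> C" for q r
      using that by (auto simp: Chains_def relation_of_def)
    show "\<exists>u\<in>peaked p b. \<forall>r\<in>C. u \<le> r"
    proof (cases "C = {}")
      case True
      then show ?thesis using ne by auto
    next
      case False
      have sn: "cstar_seminorm A q" if "q \<in> C" for q
        using CP[OF that that] by (simp add: peaked_def)
      obtain F where F: "F \<noteq> bot" "eventually (\<lambda>q. q \<in> C) F"
        and lim: "\<And>x. x \<in> carrier A \<Longrightarrow> ((\<lambda>q. q x) \<longlongrightarrow> (INF q\<in>C. q x)) F"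
        using cstar_seminorm_chain_Inf[OF False sn chain] by blast
      define u where "u x = (if x \<in> carrier A then INF q\<in>C. q x else 0)" for x
      have lim: "((\<lambda>q. q x) \<longlongrightarrow> u x) F" if "x \<in> carrier A" for x
        using lim that by (simp add: u_def)
      have u: "u x \<le> r x" if "x \<in> carrier A" "r \<in> C" for x r
        using that seminorm_nonneg[OF sn]
        by (auto simp: u_def intro!: cINF_lower bdd_belowI[of _ 0])
      have "cstar_seminorm A u"
        by (rule cstar_seminorm_limit[OF F(1) _ lim]) (use F(2) sn in \<open>auto elim: eventually_mono\<close>)
      moreover have "u \<one> = 1"
      proof -
        have "((\<lambda>q. 1) \<longlongrightarrow> u \<one>) F"
          by (rule Lim_transform_eventually[OF lim])
            (use F(2) CP in \<open>auto elim!: eventually_mono simp: peaked_def\<close>)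
        then show ?thesis using F(1) by (simp add: tendsto_const_iff)
      qed
      moreover have "u (b \<otimes> x) = p b * u x" if x: "x \<in> carrier A" for x
      proof -
        have "((\<lambda>q. p b * q x) \<longlongrightarrow> u (b \<otimes> x)) F"
          by (rule Lim_transform_eventually[OF lim])
            (use F(2) CP x b in \<open>auto elim!: eventually_mono simp: peaked_def\<close>)
        then show ?thesis
          using tendsto_unique[OF F(1)] tendsto_mult_left[OF lim[OF x]] by blast
      qed
      moreover obtain r where r: "r \<in> C" using False by blast
      have "u x \<le> p x" if "x \<in> carrier A" for x
        using u[OF that r] CP[OF r r] that by (fastforce simp: peaked_def)
      ultimately have "u \<in> peaked p b"
        by (simp add: peaked_def u_def)
      moreover have "u \<le> r" if "r \<in> C" for r
        using u[OF _ that] CP[OF that that] by (auto simp: le_fun_def peaked_def u_def)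
      ultimately show ?thesis by blast
    qed
  qed
  then show ?thesis using that by blast
qed

text \<open>For self-adjoint \<open>c\<close> with \<open>q c > 0\<close> the peak seminorm of
  \<open>q\<close> at \<open>c\<close> is again peaked and lies below \<open>q\<close>, so
  minimality makes the two equal. Comparison with the term of index 1 then gives
  \<open>q x * q c \<le> q (x \<otimes> c)\<close>.\<close>

lemma minimal_peaked_multiplicative:
  assumes b: "b \<in> carrier A" and q: "q \<in> peaked p b"
    and min: "\<And>r. r \<in> peaked p b \<Longrightarrow> r \<le> q \<Longrightarrow> r = q"
    and x: "x \<in> carrier A" and y: "y \<in> carrier A"
  shows "q (x \<otimes> y) = q x * q y"
proof -
  have sn: "cstar_seminorm A q" using q by (simp add: peaked_def)
  have selfadjoint: "q (x \<otimes> c) = q x * q c"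
    if x: "x \<in> carrier A" and c: "c \<in> carrier A" "star A c = c" for x c
  proof (cases "q c = 0")
    case True
    then show ?thesis
      using seminorm_mult[OF sn x c(1)] seminorm_nonneg[OF sn, of "x \<otimes> c"] x c by simp
  next
    case False
    then have pos: "0 < q c" using seminorm_nonneg[OF sn c(1)] by simp
    note c = c pos
    have "peak_seminorm q c (b \<otimes> z) = p b * peak_seminorm q c z" if z: "z \<in> carrier A" for z
    proof -
      have "q ((b \<otimes> z) \<otimes> c [^] n) / q c ^ n = p b * (q (z \<otimes> c [^] n) / q c ^ n)" for n :: nat
        using q z b c by (simp add: m_assoc peaked_def)
      then have "(\<lambda>n. q ((b \<otimes> z) \<otimes> c [^] n) / q c ^ n) \<longlonglongrightarrow> p b * peak_seminorm q c z"
        using tendsto_mult_left[OF peak_tendsto[OF sn c z], of "p b"] by (simp only:)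
      then show ?thesis
        using LIMSEQ_unique[OF peak_tendsto[OF sn c, of "b \<otimes> z"]] b z by blast
    qed
    moreover have "peak_seminorm q c z \<le> p z" if "z \<in> carrier A" for z
      using peak_le[OF sn c that] q that by (fastforce simp: peaked_def)
    ultimately have "peak_seminorm q c \<in> peaked p b"
      using cstar_seminorm_peak[OF sn c] peak_one[OF sn c]
      by (simp add: peaked_def peak_seminorm_def)
    moreover have "peak_seminorm q c \<le> q"
      using peak_le[OF sn c] q by (auto simp: le_fun_def peak_seminorm_def peaked_def)
    ultimately have "peak_seminorm q c = q" by (rule min)
    then have "q x \<le> q (x \<otimes> c) / q c"
      using peak_le_term[OF sn c x, of 1] c by simp
    then have "q x * q c \<le> q (x \<otimes> c)"
      using pos by (simp add: field_simps)
    then show ?thesis using seminorm_mult[OF sn x c(1)] by simp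
  qed
  have sq: "q (star A z \<otimes> z) = (q z)\<^sup>2" "star A (star A z \<otimes> z) = star A z \<otimes> z"
    if "z \<in> carrier A" for z
    using that by (simp_all add: seminorm_star_mult[OF sn] star_mult star_star)
  \<comment> \<open>Commutativity reduces arbitrary factors to the self-adjoint case, up to squaring
    both sides.\<close>
  have "star A (x \<otimes> y) \<otimes> (x \<otimes> y) = (star A x \<otimes> x) \<otimes> (star A y \<otimes> y)"
    using x y by (simp add: star_mult m_ac)
  then have "(q (x \<otimes> y))\<^sup>2 = (q x * q y)\<^sup>2"
    using selfadjoint[of "star A x \<otimes> x" "star A y \<otimes> y"] sq[OF x] sq[OF y] sq(1)[of "x \<otimes> y"] x y
    by (simp add: power_mult_distrib)
  then show ?thesis
    using seminorm_nonneg[OF sn] x y by (simp add: power2_eq_iff_nonneg)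
qed

text \<open>Mazur's theorem in Ostrowski's form: if \<open>z \<mapsto> q (x - z)\<close> had a positive minimum \<open>m\<close>, then
  factoring \<open>y\<^sup>N - \<zeta>\<^sup>N\<close> for \<open>N = 2\<^sup>j\<close>, \<open>y = x - w\<close> shows that the set of minimizers \<open>w\<close> is
  invariant under translations by \<open>\<bar>\<zeta>\<bar> < m\<close>, hence unbounded.\<close>

context
  fixes q
  assumes q: "cstar_seminorm A q" and q1: "q \<one> = 1"
    and q_mult: "\<And>x y. x \<in> carrier A \<Longrightarrow> y \<in> carrier A \<Longrightarrow> q (x \<otimes> y) = q x * q y"
begin

lemma seminorm_scalar: "q (scalar z) = cmod z"
  by (simp add: seminorm_smult[OF q] q1)

lemma square_diff_factor:
  assumes y: "y \<in> carrier A"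
  shows "y [^] ((2::nat) ^ Suc j) \<ominus> scalar (u\<^sup>2)
    = (y [^] ((2::nat) ^ j) \<ominus> scalar u) \<otimes> (y [^] ((2::nat) ^ j) \<ominus> scalar (- u))"
proof -
  have "y [^] ((2::nat) ^ Suc j) = y [^] ((2::nat) ^ j) \<otimes> y [^] ((2::nat) ^ j)"
    using y nat_pow_mult[of y "2 ^ j" "2 ^ j"] by (simp add: mult_2)
  moreover have "scalar (u\<^sup>2) = scalar u \<otimes> scalar u"
    by (simp add: power2_eq_square scalar_mult)
  moreover have "y [^] ((2::nat) ^ j) \<in> carrier A" "scalar u \<in> carrier A"
    using y by auto
  ultimately show ?thesis
    unfolding scalar_uminus by algebra
qed

lemma seminorm_shift_le_min:
  assumes y: "y \<in> carrier A" and m: "0 < m" "q y = m" "\<And>z. m \<le> q (y \<ominus> scalar z)"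
    and \<zeta>: "cmod \<zeta> < m"
  shows "q (y \<ominus> scalar \<zeta>) = m"
proof -
  \<comment> \<open>Repeated square roots of \<open>z\<close> split the difference into
    \<open>2 ^ j\<close> factors \<open>y \<ominus> scalar w\<close>, each of value at least
    \<open>m\<close>.\<close>
  have lower: "m ^ (2 ^ j) \<le> q (y [^] ((2::nat) ^ j) \<ominus> scalar z)" for j z
  proof (induction j arbitrary: z)
    case 0
    then show ?case using m(3) y by simp
  next
    case (Suc j)
    have "m ^ (2 ^ Suc j) = m ^ (2 ^ j) * m ^ (2 ^ j)"
      by (simp add: mult_2 power_add)
    also have "\<dots> \<le> q (y [^] ((2::nat) ^ j) \<ominus> scalar (csqrt z))
        * q (y [^] ((2::nat) ^ j) \<ominus> scalar (- csqrt z))"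
      by (intro mult_mono Suc.IH) (use m y seminorm_nonneg[OF q] in auto)
    also have "\<dots> = q (y [^] ((2::nat) ^ Suc j) \<ominus> scalar ((csqrt z)\<^sup>2))"
      unfolding square_diff_factor[OF y] using y by (simp add: q_mult)
    finally show ?case by simp
  qed
  \<comment> \<open>The factor with root \<open>\<zeta>\<close> is kept and each of the other
    \<open>2 ^ j - 1\<close> is bounded below by \<open>m\<close>. The extra \<open>m\<close> on the
    right avoids the subtraction in the exponent.\<close>
  have step: "q (y \<ominus> scalar \<zeta>) * m ^ (2 ^ j)
      \<le> q (y [^] ((2::nat) ^ j) \<ominus> scalar (\<zeta> ^ (2 ^ j))) * m" for j
  proof (induction j)
    case 0
    then show ?case using y by simp
  next
    case (Suc j)
    have "q (y \<ominus> scalar \<zeta>) * m ^ (2 ^ Suc j)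
        = (q (y \<ominus> scalar \<zeta>) * m ^ (2 ^ j)) * m ^ (2 ^ j)"
      by (simp add: mult_2 power_add)
    also have "\<dots> \<le> (q (y [^] ((2::nat) ^ j) \<ominus> scalar (\<zeta> ^ (2 ^ j))) * m)
        * q (y [^] ((2::nat) ^ j) \<ominus> scalar (- (\<zeta> ^ (2 ^ j))))"
      by (intro mult_mono Suc.IH lower) (use m y seminorm_nonneg[OF q] in auto)
    also have "\<dots> = q (y [^] ((2::nat) ^ Suc j) \<ominus> scalar ((\<zeta> ^ (2 ^ j))\<^sup>2)) * m"
      unfolding square_diff_factor[OF y] using y by (simp add: q_mult)
    also have "(\<zeta> ^ (2 ^ j))\<^sup>2 = \<zeta> ^ (2 ^ Suc j)"
      by (simp add: power_mult[symmetric] mult.commute)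
    finally show ?case .
  qed
  have pow: "q (y [^] n) = m ^ n" for n :: nat
    by (induction n) (use y m q1 in \<open>auto simp: q_mult\<close>)
  have bound: "q (y \<ominus> scalar \<zeta>) \<le> m * (1 + (cmod \<zeta> / m) ^ (2 ^ j))" for j
  proof -
    have "q (y [^] ((2::nat) ^ j) \<ominus> scalar (\<zeta> ^ (2 ^ j))) \<le> m ^ (2 ^ j) + cmod \<zeta> ^ (2 ^ j)"
      using seminorm_diff[OF q, of "y [^] ((2::nat) ^ j)" "scalar (\<zeta> ^ (2 ^ j))"] y
      by (simp add: pow seminorm_scalar norm_power)
    then have "q (y \<ominus> scalar \<zeta>) * m ^ (2 ^ j) \<le> (m ^ (2 ^ j) + cmod \<zeta> ^ (2 ^ j)) * m"
      using step[of j] m(1) by (meson mult_right_mono order_trans less_imp_le)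
    then show ?thesis
      using m(1) by (simp add: field_simps)
  qed
  have "(\<lambda>n. (cmod \<zeta> / m) ^ n) \<longlonglongrightarrow> 0"
    using \<zeta> m(1) by (intro LIMSEQ_power_zero) simp
  then have "(\<lambda>j. (cmod \<zeta> / m) ^ (2 ^ j)) \<longlonglongrightarrow> 0"
    using LIMSEQ_subseq_LIMSEQ[of _ _ "\<lambda>j. 2 ^ j"] by (fastforce simp: strict_mono_def o_def)
  then have "(\<lambda>j. m * (1 + (cmod \<zeta> / m) ^ (2 ^ j))) \<longlonglongrightarrow> m * (1 + 0)"
    by (intro tendsto_intros)
  then have "q (y \<ominus> scalar \<zeta>) \<le> m"
    using bound by (intro LIMSEQ_le_const[of _ _ "q (y \<ominus> scalar \<zeta>)"]) auto
  then show ?thesis using m(3)[of \<zeta>] by simp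
qed

lemma multiplicative_seminorm_scalar:
  assumes x: "x \<in> carrier A"
  shows "\<exists>z. q (x \<ominus> scalar z) = 0"
proof -
  let ?f = "\<lambda>z. q (x \<ominus> scalar z)"
  have lip: "?f z \<le> ?f w + cmod (z - w)" for z w
    using seminorm_diff_triangle[OF q x, of "scalar w" "scalar z"] seminorm_scalar[of "w - z"]
    by (simp add: scalar_diff norm_minus_commute)
  have "dist (?f z) (?f w) \<le> dist z w" for z w
    using lip[of z w] lip[of w z] norm_minus_commute[of z w] by (simp add: dist_norm abs_le_iff)
  then have cont: "continuous_on UNIV ?f"
    unfolding continuous_on_iff by (meson le_less_trans)
  have grow: "cmod z - q x \<le> ?f z" for z
    using seminorm_le_add_diff[OF q, of "scalar z" x] seminorm_diff_commute[OF q x, of "scalar z"] x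
    by (simp add: seminorm_scalar)
  \<comment> \<open>Outside this disc \<open>?f z \<ge> cmod z - q x > q x = ?f 0\<close>, so a
    minimum over the disc is a global one.\<close>
  define R where "R = 2 * q x"
  have "0 \<le> R" using seminorm_nonneg[OF q x] by (simp add: R_def)
  then have "cball (0::complex) R \<noteq> {}" by simp
  then obtain w where w: "w \<in> cball 0 R" "\<And>z. z \<in> cball 0 R \<Longrightarrow> ?f w \<le> ?f z"
    using continuous_attains_inf[OF compact_cball _ continuous_on_subset[OF cont], of 0 R] by blast
  have w_min: "?f w \<le> ?f z" for z
  proof (cases "z \<in> cball 0 R")
    case False
    have "?f w \<le> ?f 0" using w(2)[of 0] \<open>0 \<le> R\<close> by simp
    also have "\<dots> = q x" using x by (simp add: a_minus_def)
    also have "\<dots> \<le> ?f z" using grow[of z] False by (simp add: R_def)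
    finally show ?thesis .
  qed (use w in auto)
  show ?thesis
  proof (rule ccontr)
    assume nz: "\<not> ?thesis"
    define m where "m = ?f w"
    have m: "0 < m"
      using nz seminorm_nonneg[OF q, of "x \<ominus> scalar w"] x
      by (auto simp: m_def order_less_le)
    have shift: "(x \<ominus> scalar v) \<ominus> scalar z = x \<ominus> scalar (v + z)" for v z
    proof -
      have "scalar v \<in> carrier A" "scalar z \<in> carrier A" by auto
      then show ?thesis using x unfolding scalar_add by algebra
    qed
    \<comment> \<open>Any step shorter than \<open>m\<close> leads from a minimizer to a minimizer.
      Steps of length \<open>m / 2\<close> along the real axis leave every disc, against the linear
      growth of \<open>?f\<close>.\<close>
    have "?f (w + of_nat k * of_real (m / 2)) = m" for k
    proof (induction k)
      case 0
      then show ?case by (simp add: m_def)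
    next
      case (Suc k)
      let ?v = "w + of_nat k * of_real (m / 2)"
      have "q ((x \<ominus> scalar ?v) \<ominus> scalar (of_real (m / 2))) = m"
        by (rule seminorm_shift_le_min)
          (use x m Suc w_min in \<open>auto simp: shift m_def[symmetric]\<close>)
      then show ?case
        by (simp add: shift algebra_simps add_divide_distrib)
    qed
    then have *: "cmod (w + of_nat k * of_real (m / 2)) \<le> m + q x" for k
      using grow[of "w + of_nat k * of_real (m / 2)"] by simp
    have "real k * (m / 2) \<le> m + q x + cmod w" for k
      using *[of k] norm_triangle_ineq4[of "w + of_nat k * of_real (m / 2)" w] m
      by (simp add: norm_mult)
    moreover obtain k where "m + q x + cmod w < real k * (m / 2)"
      using reals_Archimedean3[of "m / 2"] m by (metis half_gt_zero)
    ultimately show False by (meson not_le)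
  qed
qed

end

text \<open>Characters vanish outside \<open>carrier A\<close>, so that they carry the topology of the function type.\<close>

definition characters_below :: "('a \<Rightarrow> real) \<Rightarrow> ('a \<Rightarrow> complex) set" where
  "characters_below p = {\<phi>.
     (\<forall>x. x \<notin> carrier A \<longrightarrow> \<phi> x = 0) \<and> \<phi> \<one> = 1 \<and>
     (\<forall>x\<in>carrier A. \<forall>y\<in>carrier A. \<phi> (x \<oplus> y) = \<phi> x + \<phi> y) \<and>
     (\<forall>x\<in>carrier A. \<forall>y\<in>carrier A. \<phi> (x \<otimes> y) = \<phi> x * \<phi> y) \<and>
     (\<forall>c. \<forall>x\<in>carrier A. \<phi> (c \<odot> x) = c * \<phi> x) \<and>
     (\<forall>x\<in>carrier A. \<phi> (star A x) = cnj (\<phi> x)) \<and>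
     (\<forall>x\<in>carrier A. cmod (\<phi> x) \<le> p x)}"

text \<open>The value of the character at \<open>x\<close> is the \<open>z\<close> with
  \<open>q (x \<ominus> scalar z) = 0\<close>. It is unique because \<open>q\<close> is the modulus
  on scalars, and every algebraic law reduces to this uniqueness: the proposed value differs from
  the element by something on which \<open>q\<close> vanishes.\<close>

lemma character_of_multiplicative_seminorm:
  assumes q: "cstar_seminorm A q" and q1: "q \<one> = 1"
    and q_mult: "\<And>x y. x \<in> carrier A \<Longrightarrow> y \<in> carrier A \<Longrightarrow> q (x \<otimes> y) = q x * q y"
  obtains \<phi> where "\<phi> \<in> characters_below q" "\<And>x. x \<in> carrier A \<Longrightarrow> cmod (\<phi> x) = q x"
proof -
  have "\<exists>z. (x \<in> carrier A \<longrightarrow> q (x \<ominus> scalar z) = 0) \<and> (x \<notin> carrier A \<longrightarrow> z = 0)" for x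
    using multiplicative_seminorm_scalar[OF q q1 q_mult] by blast
  then obtain \<phi> where \<phi>: "\<And>x. x \<in> carrier A \<Longrightarrow> q (x \<ominus> scalar (\<phi> x)) = 0"
    and \<phi>0: "\<And>x. x \<notin> carrier A \<Longrightarrow> \<phi> x = 0" by metis
  have q_scalar: "q (scalar z) = cmod z" for z
    by (rule seminorm_scalar[OF q q1 q_mult])
  have uniq: "\<phi> x = z" if x: "x \<in> carrier A" and le: "q (x \<ominus> scalar z) \<le> 0" for x z
  proof -
    have "cmod (z - \<phi> x) = q (scalar z \<ominus> scalar (\<phi> x))"
      using q_scalar by (simp flip: scalar_diff)
    also have "\<dots> \<le> q (scalar z \<ominus> x) + q (x \<ominus> scalar (\<phi> x))"
      using x by (intro seminorm_diff_triangle[OF q]) auto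
    also have "q (scalar z \<ominus> x) = q (x \<ominus> scalar z)"
      using x by (intro seminorm_diff_commute[OF q]) auto
    finally have "cmod (z - \<phi> x) \<le> 0"
      using le \<phi>[OF x] by linarith
    then show ?thesis by simp
  qed
  have norm: "cmod (\<phi> x) = q x" if x: "x \<in> carrier A" for x
    using seminorm_le_add_diff[OF q, of x "scalar (\<phi> x)"]
      seminorm_le_add_diff[OF q, of "scalar (\<phi> x)" x]
      seminorm_diff_commute[OF q x, of "scalar (\<phi> x)"] \<phi>[OF x] x
    by (simp add: q_scalar)
  have one: "\<phi> \<one> = 1"
    by (rule uniq) (use seminorm_zero[OF q] in \<open>auto simp: a_minus_def r_neg\<close>)
  have add: "\<phi> (x \<oplus> y) = \<phi> x + \<phi> y" if x: "x \<in> carrier A" and y: "y \<in> carrier A" for x y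
  proof (rule uniq)
    have "(x \<oplus> y) \<ominus> scalar (\<phi> x + \<phi> y) = (x \<ominus> scalar (\<phi> x)) \<oplus> (y \<ominus> scalar (\<phi> y))"
      using x y smult_in_carrier[OF one_closed, of "\<phi> x"] smult_in_carrier[OF one_closed, of "\<phi> y"]
      unfolding scalar_add by algebra
    then show "q ((x \<oplus> y) \<ominus> scalar (\<phi> x + \<phi> y)) \<le> 0"
      using seminorm_add[OF q, of "x \<ominus> scalar (\<phi> x)" "y \<ominus> scalar (\<phi> y)"] \<phi> x y by simp
  qed (use x y in auto)
  have mult: "\<phi> (x \<otimes> y) = \<phi> x * \<phi> y" if x: "x \<in> carrier A" and y: "y \<in> carrier A" for x y
  proof (rule uniq)
    have "(x \<otimes> y) \<ominus> scalar (\<phi> x * \<phi> y)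
        = (x \<ominus> scalar (\<phi> x)) \<otimes> y \<oplus> scalar (\<phi> x) \<otimes> (y \<ominus> scalar (\<phi> y))"
      using x y smult_in_carrier[OF one_closed, of "\<phi> x"] smult_in_carrier[OF one_closed, of "\<phi> y"]
      unfolding scalar_mult by algebra
    then show "q ((x \<otimes> y) \<ominus> scalar (\<phi> x * \<phi> y)) \<le> 0"
      using seminorm_add[OF q, of "(x \<ominus> scalar (\<phi> x)) \<otimes> y" "scalar (\<phi> x) \<otimes> (y \<ominus> scalar (\<phi> y))"]
        \<phi> x y by (simp add: q_mult)
  qed (use x y in auto)
  have smult: "\<phi> (c \<odot> x) = c * \<phi> x" if x: "x \<in> carrier A" for c x
  proof -
    have "\<phi> (scalar c) = c"
      by (rule uniq) (use seminorm_zero[OF q] in \<open>auto simp: a_minus_def r_neg\<close>)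
    then show ?thesis
      using mult[of "scalar c" x] x by (simp add: smult_eq_scalar_mult[symmetric])
  qed
  have star: "\<phi> (star A x) = cnj (\<phi> x)" if x: "x \<in> carrier A" for x
  proof (rule uniq)
    have "star A x \<ominus> scalar (cnj (\<phi> x)) = star A (x \<ominus> scalar (\<phi> x))"
      using x by (simp add: a_minus_def star_add star_minus star_smult)
    then show "q (star A x \<ominus> scalar (cnj (\<phi> x))) \<le> 0"
      using seminorm_star[OF q, of "x \<ominus> scalar (\<phi> x)"] \<phi>[OF x] x by simp
  qed (use x in auto)
  show ?thesis
    by (rule that[of \<phi>])
      (use \<phi>0 one add mult smult star norm in \<open>auto simp: characters_below_def\<close>)
qed

text \<open>Peak seminorms need a self-adjoint element, so \<open>b = star A a \<otimes> a\<close>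
  replaces \<open>a\<close>. Evaluating the peak condition at the unit gives
  \<open>q b = p b\<close>, which is \<open>q a = p a\<close> after square roots.\<close>

theorem character_attaining_seminorm:
  assumes p: "cstar_seminorm A p" and a: "a \<in> carrier A" "0 < p a"
  obtains \<phi> where "\<phi> \<in> characters_below p" "cmod (\<phi> a) = p a"
proof -
  define b where "b = star A a \<otimes> a"
  have pb: "p b = (p a)\<^sup>2" using a by (simp add: b_def seminorm_star_mult[OF p])
  then have b: "b \<in> carrier A" "star A b = b" "0 < p b"
    using a by (auto simp: b_def star_mult star_star)
  obtain q where q: "q \<in> peaked p b" and min: "\<And>r. r \<in> peaked p b \<Longrightarrow> r \<le> q \<Longrightarrow> r = q"
    using minimal_peaked[OF p b] by blast
  have sn: "cstar_seminorm A q" "q \<one> = 1" "\<And>x. x \<in> carrier A \<Longrightarrow> q x \<le> p x"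
    using q by (auto simp: peaked_def)
  obtain \<phi> where \<phi>: "\<phi> \<in> characters_below q" "\<And>x. x \<in> carrier A \<Longrightarrow> cmod (\<phi> x) = q x"
    using character_of_multiplicative_seminorm[OF sn(1,2)]
      minimal_peaked_multiplicative[OF b(1) q min] by blast
  have "q (b \<otimes> \<one>) = p b * q \<one>"
    using q unfolding peaked_def by blast
  then have "(q a)\<^sup>2 = (p a)\<^sup>2"
    using b(1) sn(2) pb seminorm_star_mult[OF sn(1) a(1)] by (simp add: b_def)
  then have "q a = p a"
    using seminorm_nonneg[OF sn(1) a(1)] a by (simp add: power2_eq_iff_nonneg)
  moreover have "\<phi> \<in> characters_below p"
    using \<phi>(1) sn(3) by (fastforce simp: characters_below_def)
  ultimately show ?thesis using that \<phi>(2)[OF a(1)] by simp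
qed

end

section \<open>The compact-open topology\<close>

text \<open>Lets the limit rules for \<open>tendsto\<close> prove continuity of arithmetic
  expressions on an abstract topology.\<close>

lemma continuous_map_euclidean_tendsto:
  "continuous_map X euclidean f \<longleftrightarrow> (\<forall>x\<in>topspace X. (f \<longlongrightarrow> f x) (atin X x))"
  by (simp add: continuous_map_atin)

lemma continuous_map_compose_continuous_on:
  assumes "continuous_map X euclidean f" "continuous_on UNIV h"
  shows "continuous_map X euclidean (\<lambda>x. h (f x))"
  using continuous_map_compose[OF assms(1), of euclidean h] assms(2) by (simp add: o_def)

lemma compactin_continuous_less_uniform:
  fixes u :: "'x \<Rightarrow> real"
  assumes K: "compactin X K" and u: "continuous_map X euclideanreal u"
    and less: "\<And>x. x \<in> K \<Longrightarrow> u x < e"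
  obtains d where "0 < d" "\<And>x. x \<in> K \<Longrightarrow> u x + d \<le> e"
proof (cases "K = {}")
  case True
  then show ?thesis using that[of 1] by simp
next
  case False
  have "compact (u ` K)"
    using image_compactin[OF K u] by simp
  then obtain x where "x \<in> K" "\<And>y. y \<in> K \<Longrightarrow> u y \<le> u x"
    using False compact_attains_sup[of "u ` K"] by blast
  then show ?thesis
    using that[of "e - u x"] less[of x] by force
qed

lemma cfun_algebra_simps [simp]:
  "carrier (cfun_algebra X) = cfun_carrier X"
  "\<one>\<^bsub>cfun_algebra X\<^esub> = (\<lambda>x\<in>topspace X. 1)"
  "\<zero>\<^bsub>cfun_algebra X\<^esub> = (\<lambda>x\<in>topspace X. 0)"
  "f \<otimes>\<^bsub>cfun_algebra X\<^esub> g = (\<lambda>x\<in>topspace X. f x * g x)"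
  "f \<oplus>\<^bsub>cfun_algebra X\<^esub> g = (\<lambda>x\<in>topspace X. f x + g x)"
  "c \<odot>\<^bsub>cfun_algebra X\<^esub> f = (\<lambda>x\<in>topspace X. c * f x)"
  "star (cfun_algebra X) f = (\<lambda>x\<in>topspace X. cnj (f x))"
  "alg_topology (cfun_algebra X) = compact_open_topology X"
  by (simp_all add: cfun_algebra_def)

lemma restrict_in_cfun_carrier_iff [simp]:
  "restrict f (topspace X) \<in> cfun_carrier X \<longleftrightarrow> continuous_map X euclidean f"
  by (auto simp: cfun_carrier_def elim: continuous_map_eq)

lemma openin_compact_open_ball:
  assumes "f \<in> cfun_carrier X" "compactin X K" "0 < e"
  shows "openin (compact_open_topology X) {g \<in> cfun_carrier X. \<forall>x\<in>K. cmod (g x - f x) < e}"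
  unfolding compact_open_topology_def by (rule topology_generated_by_Basis) (use assms in blast)

lemma topspace_compact_open_topology [simp]:
  "topspace (compact_open_topology X) = cfun_carrier X"
proof
  show "topspace (compact_open_topology X) \<subseteq> cfun_carrier X"
    unfolding compact_open_topology_def topology_generated_by_topspace by blast
  show "cfun_carrier X \<subseteq> topspace (compact_open_topology X)"
    using openin_compact_open_ball[of _ X "{}" 1] openin_subset by fastforce
qed

text \<open>The generating balls have arbitrary centres. On a compact \<open>K\<close> the distance
  from \<open>f\<close> to another centre attains its maximum, which leaves a uniform margin for a
  ball around \<open>f\<close>; finite intersections are handled by unions of compact sets.\<close>

lemma openin_compact_open_contains_ball:
  assumes "openin (compact_open_topology X) U" "f \<in> U"
  shows "\<exists>K e. compactin X K \<and> 0 < e \<and>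
           {g \<in> cfun_carrier X. \<forall>x\<in>K. cmod (g x - f x) < e} \<subseteq> U"
proof -
  have "f \<in> cfun_carrier X"
    using openin_subset[OF assms(1)] assms(2) by auto
  then have f: "continuous_map X euclidean f" by (simp add: cfun_carrier_def)
  have "generate_topology_on {{g \<in> cfun_carrier X. \<forall>x\<in>K. cmod (g x - f x) < e} | f K e.
        f \<in> cfun_carrier X \<and> compactin X K \<and> 0 < e} U"
    using assms(1) unfolding compact_open_topology_def openin_topology_generated_by_iff .
  then show ?thesis
    using assms(2)
  proof induction
    case (Int a b)
    then obtain K d L e where
      "compactin X K" "0 < d" "{g \<in> cfun_carrier X. \<forall>x\<in>K. cmod (g x - f x) < d} \<subseteq> a"
      "compactin X L" "0 < e" "{g \<in> cfun_carrier X. \<forall>x\<in>L. cmod (g x - f x) < e} \<subseteq> b"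
      by auto
    then show ?case
      by (intro exI[of _ "K \<union> L"] exI[of _ "min d e"] conjI) (auto simp: compactin_Un)
  next
    case (Basis s)
    then obtain h K e where s: "s = {g \<in> cfun_carrier X. \<forall>x\<in>K. cmod (g x - h x) < e}"
      and h: "continuous_map X euclidean h" and K: "compactin X K"
      by (auto simp: cfun_carrier_def)
    have "continuous_map X euclideanreal (\<lambda>x. cmod (f x - h x))"
      using f h unfolding continuous_map_euclidean_tendsto by (auto intro!: tendsto_intros)
    then obtain d where d: "0 < d" "\<And>x. x \<in> K \<Longrightarrow> cmod (f x - h x) + d \<le> e"
      using compactin_continuous_less_uniform[OF K, of "\<lambda>x. cmod (f x - h x)" e] Basis s by auto
    have "cmod (g x - h x) < e" if "x \<in> K" "cmod (g x - f x) < d" for g x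
      using d(2)[OF that(1)] that(2) norm_triangle_ineq[of "g x - f x" "f x - h x"] by simp
    then have sub: "{g \<in> cfun_carrier X. \<forall>x\<in>K. cmod (g x - f x) < d} \<subseteq> s"
      unfolding s by blast
    show ?case
      by (rule exI[of _ K], rule exI[of _ d]) (intro conjI K d(1) sub)
  next
    case Empty
    then show ?case by simp
  next
    case (UN C)
    then obtain a where a: "a \<in> C" "f \<in> a" by blast
    then obtain K e where "compactin X K \<and> 0 < e \<and>
        {g \<in> cfun_carrier X. \<forall>x\<in>K. cmod (g x - f x) < e} \<subseteq> a"
      using UN.IH[OF a] by (elim exE)
    then show ?case
      using a(1) by (intro exI[of _ K] exI[of _ e]) (auto dest: subsetD)
  qed
qed

lemma closedin_compact_open_approx:
  assumes B: "closedin (compact_open_topology X) B" and f: "f \<in> cfun_carrier X"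
    and approx: "\<And>K e. compactin X K \<Longrightarrow> 0 < e \<Longrightarrow> \<exists>g\<in>B. \<forall>x\<in>K. cmod (g x - f x) < e"
  shows "f \<in> B"
proof (rule ccontr)
  assume "f \<notin> B"
  moreover have "openin (compact_open_topology X) (cfun_carrier X - B)"
    using B by (simp add: closedin_def)
  ultimately obtain K e where "compactin X K" "0 < e"
    "{g \<in> cfun_carrier X. \<forall>x\<in>K. cmod (g x - f x) < e} \<subseteq> cfun_carrier X - B"
    using openin_compact_open_contains_ball[of X "cfun_carrier X - B" f] f by auto
  then show False
    using approx[of K e] closedin_subset[OF B] by fastforce
qed

text \<open>Will be applied to \<open>nat\<close>, whose topology is discrete:
  \<open>nat \<Rightarrow>\<^sub>C complex\<close> is then the Banach space of all bounded
  sequences.\<close>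

lemma complete_UNIV_bcontfun:
  "complete (UNIV :: ('a::topological_space \<Rightarrow>\<^sub>C 'b::complete_space) set)"
proof (rule completeI)
  fix f :: "nat \<Rightarrow> 'a \<Rightarrow>\<^sub>C 'b" assume "Cauchy f"
  then have "uniformly_Cauchy_on UNIV (\<lambda>n. apply_bcontfun (f n))"
    unfolding Cauchy_def uniformly_Cauchy_on_def by (meson dist_fun_lt_imp_dist_val_lt)
  then obtain g where "uniform_limit UNIV (\<lambda>n. apply_bcontfun (f n)) g sequentially"
    using Cauchy_uniformly_convergent uniformly_convergent_on_def by blast
  then obtain l where "f \<longlonglongrightarrow> l"
    using uniform_limit_bcontfunE[of f g sequentially] by auto
  then show "\<exists>l\<in>UNIV. f \<longlonglongrightarrow> l" by blast
qed

section \<open>Locally dominated series\<close>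

text \<open>The index \<open>N\<close> may depend on the point, so locally finite families are
  covered (with \<open>M = 0\<close>) along with globally dominated series.\<close>

definition locally_dominated ::
    "'x topology \<Rightarrow> (nat \<Rightarrow> 'x \<Rightarrow> 'b::real_normed_vector) \<Rightarrow> bool" where
  "locally_dominated X f \<longleftrightarrow> (\<forall>x\<in>topspace X. \<exists>U N M. openin X U \<and> x \<in> U \<and> summable M \<and>
     (\<forall>n\<ge>N. \<forall>y\<in>U. norm (f n y) \<le> M n))"

lemma locally_dominatedE:
  assumes "locally_dominated X f" "x \<in> topspace X"
  obtains U N M where "openin X U" "x \<in> U" "summable M"
    "\<forall>n\<ge>N. \<forall>y\<in>U. norm (f n y) \<le> M n"
  using bspec[OF assms(1)[unfolded locally_dominated_def] assms(2)] by (elim exE conjE)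

lemma locally_dominated_norm: "locally_dominated X f \<longleftrightarrow> locally_dominated X (\<lambda>n x. norm (f n x))"
  by (simp add: locally_dominated_def)

lemma locally_dominated_summable:
  fixes f :: "nat \<Rightarrow> 'x \<Rightarrow> 'b::banach"
  assumes "locally_dominated X f" "x \<in> topspace X"
  shows "summable (\<lambda>n. norm (f n x))" "summable (\<lambda>n. f n x)"
proof -
  obtain U N M where "x \<in> U" "summable M" "\<forall>n\<ge>N. \<forall>y\<in>U. norm (f n y) \<le> M n"
    by (rule locally_dominatedE[OF assms])
  then show "summable (\<lambda>n. norm (f n x))"
    by (intro summable_comparison_test[of "\<lambda>n. norm (f n x)" M]) auto
  then show "summable (\<lambda>n. f n x)"
    by (rule summable_norm_cancel)
qed

text \<open>Weierstrass' M-test on the neighbourhood \<open>U\<close>: the tails are uniformly below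
  \<open>e / 3\<close> and the remaining partial sum is continuous.\<close>

lemma continuous_map_locally_dominated_suminf:
  fixes f :: "nat \<Rightarrow> 'x \<Rightarrow> 'b::banach"
  assumes f: "\<And>n. continuous_map X euclidean (f n)" and dom: "locally_dominated X f"
  shows "continuous_map X euclidean (\<lambda>x. \<Sum>n. f n x)"
  unfolding continuous_map_euclidean_tendsto
proof
  let ?F = "\<lambda>x. \<Sum>n. f n x"
  fix x assume x: "x \<in> topspace X"
  obtain U N M where U: "openin X U" "x \<in> U" and M: "summable M"
    and le: "\<forall>n\<ge>N. \<forall>y\<in>U. norm (f n y) \<le> M n"
    by (rule locally_dominatedE[OF dom x])
  have UT: "U \<subseteq> topspace X" using U(1) by (rule openin_subset)
  show "(?F \<longlongrightarrow> ?F x) (atin X x)"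
  proof (rule tendstoI)
    fix e :: real assume e: "0 < e"
    have "(\<lambda>k. \<Sum>n. M (n + k)) \<longlonglongrightarrow> 0"
      by (rule suminf_exist_split2[OF M])
    then have "eventually (\<lambda>k. (\<Sum>n. M (n + k)) < e / 3) sequentially"
      using e by (intro order_tendstoD(2)) auto
    then obtain k where k: "k \<ge> N" "(\<Sum>n. M (n + k)) < e / 3"
      unfolding eventually_sequentially using nat_le_linear by blast
    have tail: "norm (?F y - (\<Sum>n<k. f n y)) < e / 3" if y: "y \<in> U" for y
    proof -
      have "?F y - (\<Sum>n<k. f n y) = (\<Sum>n. f (n + k) y)"
        using suminf_minus_initial_segment[OF locally_dominated_summable(2)[OF dom]] y UT by auto
      moreover have "norm (\<Sum>n. f (n + k) y) \<le> (\<Sum>n. M (n + k))"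
      proof (rule order_trans[OF summable_norm suminf_le])
        show "summable (\<lambda>n. norm (f (n + k) y))"
          using summable_ignore_initial_segment[OF locally_dominated_summable(1)[OF dom]] y UT
          by blast
        then show "summable (\<lambda>n. norm (f (n + k) y))" .
        show "summable (\<lambda>n. M (n + k))" by (rule summable_ignore_initial_segment[OF M])
        show "norm (f (n + k) y) \<le> M (n + k)" for n
          using le k y by simp
      qed
      ultimately show ?thesis using k by simp
    qed
    have "((\<lambda>y. \<Sum>n<k. f n y) \<longlongrightarrow> (\<Sum>n<k. f n x)) (atin X x)"
      using f x unfolding continuous_map_euclidean_tendsto by (auto intro!: tendsto_intros)
    then have "eventually (\<lambda>y. dist (\<Sum>n<k. f n y) (\<Sum>n<k. f n x) < e / 3) (atin X x)"
      using e by (intro tendstoD) auto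
    moreover have "eventually (\<lambda>y. y \<in> U) (atin X x)"
      using U x by (auto simp: eventually_atin)
    ultimately show "eventually (\<lambda>y. dist (?F y) (?F x) < e) (atin X x)"
    proof eventually_elim
      case (elim y)
      then show ?case
        using tail[of y] tail[OF U(2)] by (simp add: dist_norm) norm
    qed
  qed
qed

section \<open>Barrels in algebras of continuous functions\<close>

locale cfun_barrel =
  fixes X :: "'x topology" and B
  assumes barrel: "barrel_in (cfun_algebra X) B"
begin

text \<open>Elements of the algebra are \<open>undefined\<close> off the space. This wrapper lets
  ordinary lambda terms stand for them, with equality required on \<open>topspace X\<close>
  only.\<close>

definition holds :: "('x \<Rightarrow> complex) \<Rightarrow> bool" where
  "holds f \<longleftrightarrow> restrict f (topspace X) \<in> B"

lemma holds_cong: "holds f \<Longrightarrow> (\<And>x. x \<in> topspace X \<Longrightarrow> f x = g x) \<Longrightarrow> holds g"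
  unfolding holds_def by (metis restrict_ext)

lemma holds_convex:
  assumes "holds f" "holds g" "cmod a + cmod b \<le> 1"
  shows "holds (\<lambda>x. a * f x + b * g x)"
proof -
  have convex: "\<forall>f\<in>B. \<forall>g\<in>B. \<forall>a b. cmod a + cmod b \<le> 1 \<longrightarrow>
      (\<lambda>x\<in>topspace X. (\<lambda>x\<in>topspace X. a * f x) x + (\<lambda>x\<in>topspace X. b * g x) x) \<in> B"
    using barrel unfolding barrel_in_def absolutely_convex_in_def cfun_algebra_simps by (elim conjE)
  have "(\<lambda>x\<in>topspace X. (\<lambda>x\<in>topspace X. a * restrict f (topspace X) x) x
      + (\<lambda>x\<in>topspace X. b * restrict g (topspace X) x) x) \<in> B"
    by (rule convex[rule_format, OF assms[unfolded holds_def]])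
  then show ?thesis
    unfolding holds_def by (rule back_subst[of "\<lambda>f. f \<in> B"]) auto
qed

lemma holds_absorbing:
  assumes "continuous_map X euclidean f"
  obtains r where "0 < r" "\<And>c. cmod c \<le> r \<Longrightarrow> holds (\<lambda>x. c * f x)"
proof -
  have "absorbing_in (cfun_algebra X) B"
    using barrel by (simp add: barrel_in_def)
  then have "\<exists>r>0. \<forall>c. cmod c \<le> r \<longrightarrow> (\<lambda>x\<in>topspace X. c * restrict f (topspace X) x) \<in> B"
    unfolding absorbing_in_def cfun_algebra_simps
    by (rule bspec) (simp only: restrict_in_cfun_carrier_iff assms)
  moreover have "(\<lambda>x\<in>topspace X. c * restrict f (topspace X) x) = (\<lambda>x\<in>topspace X. c * f x)" for c
    by auto
  ultimately show ?thesis
    using that unfolding holds_def by auto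
qed

lemma holds_zero: "holds (\<lambda>_. 0)"
proof -
  obtain r where "0 < r" "\<And>c. cmod c \<le> r \<Longrightarrow> holds (\<lambda>x. c * 0)"
    using holds_absorbing[of "\<lambda>_. 0"] by auto
  from this(2)[of 0] this(1) show ?thesis by simp
qed

lemma holds_closed:
  assumes f: "continuous_map X euclidean f"
    and approx: "\<And>K e. compactin X K \<Longrightarrow> 0 < e \<Longrightarrow> \<exists>g. holds g \<and> (\<forall>x\<in>K. cmod (g x - f x) < e)"
  shows "holds f"
  unfolding holds_def
proof (rule closedin_compact_open_approx)
  show "closedin (compact_open_topology X) B"
    using barrel by (simp add: barrel_in_def)
  show "restrict f (topspace X) \<in> cfun_carrier X"
    using f by simp
  fix K and e :: real assume K: "compactin X K" "0 < e"
  then obtain g where "holds g" "\<forall>x\<in>K. cmod (g x - f x) < e"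
    using approx by blast
  moreover have "K \<subseteq> topspace X" using K(1) by (rule compactin_subset_topspace)
  ultimately show "\<exists>g\<in>B. \<forall>x\<in>K. cmod (g x - restrict f (topspace X) x) < e"
    unfolding holds_def by (intro bexI[of _ "restrict g (topspace X)"]) auto
qed

text \<open>The sequences \<open>c\<close> with \<open>\<Sum>n. c n * f n\<close> in \<open>B\<close> form a barrel in the Banach space of bounded
  sequences.\<close>

lemma holds_locally_dominated_uniform:
  assumes f: "\<And>n. continuous_map X euclidean (f n)" and dom: "locally_dominated X f"
  obtains d where "0 < d" "\<forall>n c. cmod c \<le> d \<longrightarrow> holds (\<lambda>x. c * f n x)"
proof -
  define T where "T c x = (\<Sum>n. apply_bcontfun c n * f n x)" for c :: "nat \<Rightarrow>\<^sub>C complex" and x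
  have dom_c: "locally_dominated X (\<lambda>n x. apply_bcontfun c n * f n x)" for c :: "nat \<Rightarrow>\<^sub>C complex"
    unfolding locally_dominated_def
  proof
    fix x assume x: "x \<in> topspace X"
    obtain U N M where "openin X U" "x \<in> U" "summable M"
      "\<forall>n\<ge>N. \<forall>y\<in>U. cmod (f n y) \<le> M n"
      by (rule locally_dominatedE[OF dom x])
    then show "\<exists>U N M. openin X U \<and> x \<in> U \<and> summable M \<and>
        (\<forall>n\<ge>N. \<forall>y\<in>U. cmod (apply_bcontfun c n * f n y) \<le> M n)"
      by (intro exI[of _ U] exI[of _ N] exI[of _ "\<lambda>n. norm c * M n"])
        (auto simp: norm_mult norm_bounded intro!: mult_mono summable_mult)
  qed
  note summ = locally_dominated_summable(2)[OF dom_c]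
  have T_cont: "continuous_map X euclidean (T c)" for c
    unfolding T_def
    by (rule continuous_map_locally_dominated_suminf[OF _ dom_c])
      (use f in \<open>auto simp: continuous_map_euclidean_tendsto intro!: tendsto_intros\<close>)
  have T_diff: "T c x - T d x = T (c - d) x" if "x \<in> topspace X" for c d x
    using suminf_diff[OF summ summ, OF that that, of c d] by (simp add: T_def left_diff_distrib)
  have T_scale: "T (a *\<^sub>R c) x = of_real a * T c x" if "x \<in> topspace X" for a c x
    using suminf_mult[OF summ[OF that], of "of_real a" c]
    by (simp add: T_def scaleR_conv_of_real mult.assoc)
  define S where "S = {c. holds (T c)}"
  have "closed S"
    unfolding closed_def[symmetric] closure_subset_eq[symmetric]
  proof
    fix c assume c: "c \<in> closure S"
    have "holds (T c)"
    proof (rule holds_closed[OF T_cont])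
      fix K and e :: real assume K: "compactin X K" and e: "0 < e"
      \<comment> \<open>This sum is continuous, hence bounded on \<open>K\<close> by some
        \<open>P\<close>. So \<open>T\<close> is Lipschitz in the sequence with constant
        \<open>P\<close>, uniformly on \<open>K\<close>.\<close>
      have cont: "continuous_map X euclideanreal (\<lambda>x. \<Sum>n. cmod (f n x))"
        by (rule continuous_map_locally_dominated_suminf)
          (use f dom in \<open>auto simp: continuous_map_euclidean_tendsto intro!: tendsto_intros
            simp flip: locally_dominated_norm\<close>)
      have "compact ((\<lambda>x. \<Sum>n. cmod (f n x)) ` K)"
        using image_compactin[OF K cont] by (simp only: compactin_euclidean_iff)
      then have "bounded ((\<lambda>x. \<Sum>n. cmod (f n x)) ` K)"
        by (rule compact_imp_bounded)
      then obtain P where P: "0 < P" "\<forall>y\<in>(\<lambda>x. \<Sum>n. cmod (f n x)) ` K. norm y \<le> P"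
        unfolding bounded_pos by (elim exE conjE)
      obtain d where d: "d \<in> S" "dist d c < e / P"
        using c e P(1) unfolding closure_approachable by (meson divide_pos_pos)
      have "cmod (T d x - T c x) < e" if x: "x \<in> K" for x
      proof -
        have xT: "x \<in> topspace X" using K x compactin_subset_topspace by blast
        note sn = locally_dominated_summable(1)[OF dom xT]
        have le: "cmod (apply_bcontfun (d - c) n * f n x) \<le> norm (d - c) * cmod (f n x)" for n
          unfolding norm_mult by (intro mult_right_mono norm_bounded) auto
        have "cmod (T (d - c) x) \<le> (\<Sum>n. norm (d - c) * cmod (f n x))"
          unfolding T_def
          by (intro order_trans[OF summable_norm suminf_le] le
              locally_dominated_summable(1)[OF dom_c xT] summable_mult sn)
        also have "\<dots> = norm (d - c) * (\<Sum>n. cmod (f n x))"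
          by (rule suminf_mult[OF sn])
        also have "\<dots> \<le> norm (d - c) * P"
          using P(2) x by (intro mult_left_mono) auto
        also have "\<dots> < e"
          using d(2) P(1) by (simp add: dist_norm field_simps)
        finally show ?thesis using T_diff[OF xT] by simp
      qed
      then show "\<exists>g. holds g \<and> (\<forall>x\<in>K. cmod (g x - T c x) < e)"
        using d(1) unfolding S_def by blast
    qed
    then show "c \<in> S" by (simp add: S_def)
  qed
  \<comment> \<open>The multiple of \<open>S\<close> by \<open>k + 1\<close>. These closed sets
    cover the space because \<open>B\<close> is absorbing, so Baire's theorem gives one of them an
    interior point.\<close>
  define G where "G k = {c. (1 / (real k + 1)) *\<^sub>R c \<in> S}" for k :: nat
  have "closed (G k)" for k
  proof -
    have "continuous_on UNIV (\<lambda>c :: nat \<Rightarrow>\<^sub>C complex. (1 / (real k + 1)) *\<^sub>R c)"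
      by (intro continuous_intros)
    then have "closed ((\<lambda>c. (1 / (real k + 1)) *\<^sub>R c) -` S)"
      using \<open>closed S\<close> by (rule closed_vimage[rotated])
    then show ?thesis by (simp add: G_def vimage_def)
  qed
  moreover have "(\<Union>k. G k) = UNIV"
  proof -
    have "\<exists>k. c \<in> G k" for c
    proof -
      obtain r where r: "0 < r" "\<And>a. cmod a \<le> r \<Longrightarrow> holds (\<lambda>x. a * T c x)"
        using holds_absorbing[OF T_cont[of c]] by blast
      obtain k where "1 / real (Suc k) < r"
        using nat_approx_posE[OF r(1)] by blast
      then have k: "1 / (real k + 1) \<le> r" by (simp add: add.commute)
      have "holds (T ((1 / (real k + 1)) *\<^sub>R c))"
        by (rule holds_cong[OF r(2)[of "of_real (1 / (real k + 1))"]])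
          (use k in \<open>simp_all only: T_scale norm_of_real, simp\<close>)
      then show ?thesis by (auto simp: G_def S_def)
    qed
    then show ?thesis by blast
  qed
  moreover have "Metric_space.mcomplete (UNIV :: (nat \<Rightarrow>\<^sub>C complex) set) dist"
    by (simp add: complete_UNIV_bcontfun)
  ultimately have "\<exists>k. interior (G k) \<noteq> {}"
    using Met_TC.metric_Baire_category_alt[of "range G"] by fastforce
  then obtain k where "interior (G k) \<noteq> {}" by blast
  then obtain c0 r where r: "0 < r" "ball c0 r \<subseteq> G k"
    by (meson all_not_in_conv mem_interior)
  define s where "s = 1 / (real k + 1)"
  have s: "0 < s" by (simp add: s_def)
  \<comment> \<open>The ball around \<open>c0\<close> is moved to the origin: \<open>c\<close> is
    half the difference of \<open>c0 + c\<close> and \<open>c0 - c\<close>, and the barrel is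
    absolutely convex.\<close>
  have small: "holds (T (s *\<^sub>R c))" if "norm c < r" for c
  proof -
    have "c0 + c \<in> ball c0 r" "c0 - c \<in> ball c0 r"
      using that by (auto simp: dist_norm)
    then have "c0 + c \<in> G k" "c0 - c \<in> G k"
      using r(2) by blast+
    then have "holds (T (s *\<^sub>R (c0 + c)))" "holds (T (s *\<^sub>R (c0 - c)))"
      by (simp_all add: G_def S_def s_def)
    then have "holds (\<lambda>x. 1/2 * T (s *\<^sub>R (c0 + c)) x + (- 1/2) * T (s *\<^sub>R (c0 - c)) x)"
      by (rule holds_convex) auto
    then show ?thesis
    proof (rule holds_cong)
      fix x assume x: "x \<in> topspace X"
      have "1/2 * T (s *\<^sub>R (c0 + c)) x + (- 1/2) * T (s *\<^sub>R (c0 - c)) x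
          = of_real (1/2) * (T (s *\<^sub>R (c0 + c)) x - T (s *\<^sub>R (c0 - c)) x)"
        by (simp add: algebra_simps)
      also have "\<dots> = of_real (1/2) * T (s *\<^sub>R (c0 + c) - s *\<^sub>R (c0 - c)) x"
        by (simp only: T_diff[OF x])
      also have "\<dots> = T ((1/2) *\<^sub>R (s *\<^sub>R (c0 + c) - s *\<^sub>R (c0 - c))) x"
        by (rule T_scale[OF x, symmetric])
      also have "(1/2) *\<^sub>R (s *\<^sub>R (c0 + c) - s *\<^sub>R (c0 - c)) = s *\<^sub>R c"
        by (simp add: algebra_simps flip: scaleR_add_left)
      finally show "1/2 * T (s *\<^sub>R (c0 + c)) x + (- 1/2) * T (s *\<^sub>R (c0 - c)) x = T (s *\<^sub>R c) x" .
    qed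
  qed
  show ?thesis
  proof
    show "0 < s * (r / 2)" using s r by simp
    show "\<forall>n c. cmod c \<le> s * (r / 2) \<longrightarrow> holds (\<lambda>x. c * f n x)"
    proof (intro allI impI)
      fix n :: nat and c :: complex assume c: "cmod c \<le> s * (r / 2)"
      \<comment> \<open>A sequence with one nonzero entry, so that \<open>T (s *\<^sub>R u)\<close>
        is \<open>c\<close> times \<open>f n\<close>. The bound \<open>r / 2\<close> puts it
        strictly inside the open ball of \<open>small\<close>.\<close>
      define u where "u = Bcontfun (\<lambda>m. if m = n then c / of_real s else 0)"
      have cs: "cmod (c / of_real s) \<le> r / 2"
        using c s by (simp add: norm_divide field_simps)
      have u: "apply_bcontfun u = (\<lambda>m. if m = n then c / of_real s else 0)"
        unfolding u_def
        by (intro Bcontfun_inverse bcontfun_normI[of _ "r / 2"]) (use cs r in auto)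
      have "norm u \<le> r / 2"
        by (rule norm_bound) (use cs r in \<open>auto simp: u\<close>)
      then have "holds (T (s *\<^sub>R u))"
        using r by (intro small) simp
      then show "holds (\<lambda>x. c * f n x)"
      proof (rule holds_cong)
        fix x assume "x \<in> topspace X"
        have "(\<lambda>m. apply_bcontfun (s *\<^sub>R u) m * f m x) = (\<lambda>m. if m = n then c * f n x else 0)"
          using s by (auto simp: u scaleR_conv_of_real)
        then show "T (s *\<^sub>R u) x = c * f n x"
          unfolding T_def by (simp only: sums_unique[OF sums_single, symmetric])
      qed
    qed
  qed
qed

text \<open>If every radius failed, there would be functions \<open>h n\<close> of size
  \<open>(1/4) ^ n\<close> outside the barrel. The gap between the rates 4 and 2 gives the
  contradiction: \<open>2 ^ n * h n\<close> is still dominated, so one constant \<open>d\<close>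
  serves all of these, and \<open>(1/2) ^ n < d\<close> for some \<open>n\<close>.\<close>

lemma holds_uniform_ball:
  obtains d where "0 < d"
    "\<And>f. continuous_map X euclidean f \<Longrightarrow> (\<And>x. x \<in> topspace X \<Longrightarrow> cmod (f x) \<le> d) \<Longrightarrow> holds f"
proof (rule ccontr)
  assume "\<not> thesis"
  then have "\<exists>f. continuous_map X euclidean f \<and> (\<forall>x\<in>topspace X. cmod (f x) \<le> (1/4) ^ n) \<and> \<not> holds f"
    for n :: nat
    using that[of "(1/4) ^ n"] by auto
  then obtain h where h: "\<And>n :: nat. continuous_map X euclidean (h n)"
      "\<And>n x. x \<in> topspace X \<Longrightarrow> cmod (h n x) \<le> (1/4) ^ n" "\<And>n. \<not> holds (h n)"
    by metis
  let ?f = "\<lambda>n x. 2 ^ n * h n x"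
  have "continuous_map X euclidean (?f n)" for n
    using h(1) by (auto simp: continuous_map_euclidean_tendsto intro!: tendsto_intros)
  moreover have "locally_dominated X ?f"
    unfolding locally_dominated_def
  proof
    fix x assume x: "x \<in> topspace X"
    have "cmod (?f n y) \<le> (1/2) ^ n" if "y \<in> topspace X" for n y
    proof -
      have "cmod (?f n y) \<le> 2 ^ n * (1/4) ^ n"
        using h(2)[OF that] by (simp add: norm_mult norm_power)
      also have "\<dots> = (1/2) ^ n" by (simp flip: power_mult_distrib)
      finally show ?thesis .
    qed
    moreover have "summable (\<lambda>n. (1/2 :: real) ^ n)" by (rule summable_geometric) simp
    ultimately show "\<exists>U N M. openin X U \<and> x \<in> U \<and> summable M \<and> (\<forall>n\<ge>N. \<forall>y\<in>U. cmod (?f n y) \<le> M n)"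
      using x by (intro exI[of _ "topspace X"] exI[of _ 0] exI[of _ "\<lambda>n. (1/2) ^ n"]) auto
  qed
  ultimately obtain d where d: "0 < d" "\<forall>n c. cmod c \<le> d \<longrightarrow> holds (\<lambda>x. c * ?f n x)"
    by (rule holds_locally_dominated_uniform[of ?f])
  obtain n where "(1/2 :: real) ^ n < d"
    using real_arch_pow_inv[OF d(1), of "1/2"] by auto
  then have "holds (\<lambda>x. (1/2) ^ n * ?f n x)"
    by (intro d(2)[rule_format]) (simp add: norm_power norm_divide)
  then have "holds (h n)"
    by (rule holds_cong) (simp add: power_divide)
  then show False using h(3) by blast
qed

section \<open>The support of a barrel\<close>

definition null :: "'x set \<Rightarrow> bool" where
  "null U \<longleftrightarrow> (\<forall>f. continuous_map X euclidean f \<and> (\<forall>x\<in>topspace X - U. f x = 0) \<longrightarrow> holds f)"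

text \<open>The analogue of the support of a measure. The functions vanishing off \<open>U\<close>
  form a linear space, so \<open>null U\<close> places all multiples of them in the barrel, not just
  small ones.\<close>

definition barrel_support :: "'x set" where
  "barrel_support = topspace X - \<Union> {U. openin X U \<and> null U}"

lemma closedin_barrel_support: "closedin X barrel_support"
  unfolding barrel_support_def by (intro closedin_diff openin_Union) auto

text \<open>The hypothesis covers all multiples \<open>c\<close> because a convex combination costs
  a factor 2 for each further summand.\<close>

lemma holds_sum:
  assumes "finite I" "\<And>i c. i \<in> I \<Longrightarrow> holds (\<lambda>x. c * f i x)"
  shows "holds (\<lambda>x. c * (\<Sum>i\<in>I. f i x))"
  using assms
proof (induction arbitrary: c rule: finite_induct)
  case empty
  then show ?case by (simp add: holds_zero)
next
  case (insert j I)
  have "holds (\<lambda>x. 1/2 * (2 * c * f j x) + 1/2 * (2 * c * (\<Sum>i\<in>I. f i x)))"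
    by (rule holds_convex) (use insert in auto)
  then show ?case
    by (rule holds_cong) (use insert in \<open>simp add: algebra_simps\<close>)
qed

text \<open>If \<open>g\<close> is unbounded on the support, each open set where \<bar>g\<bar>
  exceeds \<open>n\<close> meets the support and carries a function \<open>h n\<close> outside the
  barrel. Near a point with \<bar>g\<bar> below \<open>N\<close> the terms from \<open>N\<close> on
  vanish, so even the multiples by \<open>n + 1\<close> are locally dominated, and a common
  \<open>d\<close> exceeds some \<open>1 / (n + 1)\<close>.\<close>

lemma relatively_pseudocompact_barrel_support: "relatively_pseudocompact_in X barrel_support"
  unfolding relatively_pseudocompact_in_def
proof (intro conjI allI impI)
  show "barrel_support \<subseteq> topspace X" by (auto simp: barrel_support_def)
  fix g assume g: "continuous_map X euclideanreal g"
  show "bounded (g ` barrel_support)"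
  proof (rule ccontr)
    assume unbounded: "\<not> bounded (g ` barrel_support)"
    define V where "V n = {x \<in> topspace X. \<bar>g x\<bar> \<in> {real n<..}}" for n
    have abs_g: "continuous_map X euclideanreal (\<lambda>x. \<bar>g x\<bar>)"
      using g by (rule continuous_map_real_abs)
    have V_open: "openin X (V n)" for n
      unfolding V_def by (rule openin_continuous_map_preimage[OF abs_g]) simp
    have "\<not> null (V n)" for n
    proof
      assume "null (V n)"
      moreover obtain x where "x \<in> barrel_support" "real n < \<bar>g x\<bar>"
        using unbounded unfolding bounded_iff by (auto simp: not_le)
      ultimately show False
        using V_open[of n] by (auto simp: barrel_support_def V_def)
    qed
    then obtain h where h: "\<And>n. continuous_map X euclidean (h n)"
        "\<And>n x. x \<in> topspace X \<Longrightarrow> x \<notin> V n \<Longrightarrow> h n x = 0" "\<And>n. \<not> holds (h n)"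
      unfolding null_def by (metis DiffI)
    let ?f = "\<lambda>n x. (of_nat n + 1) * h n x"
    have "continuous_map X euclidean (?f n)" for n
      using h(1) by (auto simp: continuous_map_euclidean_tendsto intro!: tendsto_intros)
    moreover have "locally_dominated X ?f"
      unfolding locally_dominated_def
    proof
      fix x assume x: "x \<in> topspace X"
      obtain N :: nat where N: "\<bar>g x\<bar> < real N" using reals_Archimedean2 by blast
      let ?U = "{y \<in> topspace X. \<bar>g y\<bar> \<in> {..<real N}}"
      have "openin X ?U" by (rule openin_continuous_map_preimage[OF abs_g]) simp
      moreover have "\<forall>n\<ge>N. \<forall>y\<in>?U. cmod (?f n y) \<le> 0"
        using h(2) by (force simp: V_def)
      ultimately show "\<exists>U N M. openin X U \<and> x \<in> U \<and> summable M \<and>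
          (\<forall>n\<ge>N. \<forall>y\<in>U. cmod (?f n y) \<le> M n)"
        using x N by (intro exI[of _ ?U] exI[of _ N] exI[of _ "\<lambda>_. 0"]) auto
    qed
    ultimately obtain d where d: "0 < d" "\<forall>n c. cmod c \<le> d \<longrightarrow> holds (\<lambda>x. c * ?f n x)"
      by (rule holds_locally_dominated_uniform[of ?f])
    obtain n where "1 / real (Suc n) < d"
      using nat_approx_posE[OF d(1)] by blast
    then have n: "1 / (real n + 1) < d" by (simp add: add.commute)
    have "holds (\<lambda>x. of_real (1 / (real n + 1)) * ?f n x)"
      by (rule d(2)[rule_format]) (use n in \<open>simp only: norm_of_real, simp\<close>)
    then have "holds (h n)"
    proof (rule holds_cong)
      have "complex_of_real (1 / (real n + 1)) * (of_nat n + 1) = 1"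
        by (simp add: field_simps) (metis of_nat_Suc of_nat_neq_0 add.commute)
      then show "of_real (1 / (real n + 1)) * ?f n x = h n x" for x
        by (metis mult.assoc mult_1)
    qed
    then show False using h(3) by blast
  qed
qed

text \<open>The barrel is closed, so an approximation of \<open>f\<close> on each compact
  \<open>L\<close> suffices. Where \<bar>f\<bar> is at least \<open>e\<close> on \<open>L\<close>,
  finitely many null sets cover, and a subordinate family of bump functions cuts \<open>f\<close>
  into pieces that lie in the barrel with all their multiples.\<close>

lemma holds_vanishing_on_support:
  assumes X: "completely_regular_space X"
    and f: "continuous_map X euclidean f" and f0: "\<And>x. x \<in> barrel_support \<Longrightarrow> f x = 0"
  shows "holds f"
proof (rule holds_closed[OF f])
  fix L and e :: real assume L: "compactin X L" and e: "0 < e"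
  have LT: "L \<subseteq> topspace X" using L by (rule compactin_subset_topspace)
  define L' where "L' = {x \<in> topspace X. cmod (f x) \<in> {e..}} \<inter> L"
  have "continuous_map X euclideanreal (\<lambda>x. cmod (f x))"
    using f by (auto simp: continuous_map_euclidean_tendsto intro!: tendsto_intros)
  then have "closedin X {x \<in> topspace X. cmod (f x) \<in> {e..}}"
    by (rule closedin_continuous_map_preimage) simp
  then have L': "compactin X L'"
    unfolding L'_def using L by (rule closed_Int_compactin)
  have "\<forall>x\<in>L'. \<exists>U \<phi>. null U \<and> continuous_map X euclideanreal \<phi> \<and> \<phi> x = 1 \<and>
      (\<forall>y\<in>topspace X. 0 \<le> \<phi> y) \<and> (\<forall>y\<in>topspace X - U. \<phi> y = 0)"
  proof
    fix x assume x: "x \<in> L'"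
    have "x \<in> topspace X" "x \<notin> barrel_support" using x f0[of x] e by (auto simp: L'_def)
    then obtain U where U: "openin X U" "null U" "x \<in> U"
      unfolding barrel_support_def by blast
    then have "closedin X (topspace X - U)" "x \<in> topspace X - (topspace X - U)"
      using \<open>x \<in> topspace X\<close> by auto
    then obtain \<psi> where \<psi>: "continuous_map X (top_of_set {0..1::real}) \<psi>" "\<psi> x = 0"
        "\<psi> ` (topspace X - U) \<subseteq> {1}"
      using X unfolding completely_regular_space_def by meson
    show "\<exists>U \<phi>. null U \<and> continuous_map X euclideanreal \<phi> \<and> \<phi> x = 1 \<and>
        (\<forall>y\<in>topspace X. 0 \<le> \<phi> y) \<and> (\<forall>y\<in>topspace X - U. \<phi> y = 0)"
      using U(2) \<psi> by (intro exI[of _ U] exI[of _ "\<lambda>y. 1 - \<psi> y"])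
        (auto simp: continuous_map_in_subtopology Pi_iff intro!: continuous_map_diff)
  qed
  then obtain U \<phi> where all: "\<forall>x\<in>L'. null (U x) \<and> continuous_map X euclideanreal (\<phi> x) \<and>
      \<phi> x x = 1 \<and> (\<forall>y\<in>topspace X. 0 \<le> \<phi> x y) \<and> (\<forall>y\<in>topspace X - U x. \<phi> x y = 0)"
    unfolding bchoice_iff by (elim exE)
  then have \<phi>: "\<And>x. x \<in> L' \<Longrightarrow> null (U x)"
      "\<And>x. x \<in> L' \<Longrightarrow> continuous_map X euclideanreal (\<phi> x)" "\<And>x. x \<in> L' \<Longrightarrow> \<phi> x x = 1"
      "\<And>x y. x \<in> L' \<Longrightarrow> y \<in> topspace X \<Longrightarrow> 0 \<le> \<phi> x y"
      "\<And>x y. x \<in> L' \<Longrightarrow> y \<in> topspace X - U x \<Longrightarrow> \<phi> x y = 0"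
    by auto
  let ?V = "\<lambda>x. {y \<in> topspace X. \<phi> x y \<in> {1/2<..}}"
  have "openin X (?V x)" if "x \<in> L'" for x
    by (rule openin_continuous_map_preimage[OF \<phi>(2)[OF that]]) simp
  moreover have "L' \<subseteq> (\<Union>x\<in>L'. ?V x)"
    using \<phi>(3) LT by (auto simp: L'_def)
  ultimately obtain \<F> where \<F>: "finite \<F>" "\<F> \<subseteq> ?V ` L'" "L' \<subseteq> \<Union>\<F>"
    using L' unfolding compactin_def by (metis (no_types, lifting) image_iff)
  then obtain I where I: "finite I" "I \<subseteq> L'" "L' \<subseteq> (\<Union>x\<in>I. ?V x)"
    by (metis (no_types, lifting) finite_subset_image)
  \<comment> \<open>Some \<open>\<phi> i\<close> exceeds 1/2 at each point of \<open>L'\<close>; the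
    factor 2 turns this into \<open>\<psi> \<ge> 1\<close>.\<close>
  define \<psi> where "\<psi> y = 2 * (\<Sum>i\<in>I. \<phi> i y)" for y
  have \<psi>0: "0 \<le> \<psi> y" if "y \<in> topspace X" for y
    unfolding \<psi>_def using that I(2) \<phi>(4) by (auto intro!: sum_nonneg)
  have \<psi>1: "1 \<le> \<psi> y" if "y \<in> L'" for y
  proof -
    obtain i where i: "i \<in> I" "y \<in> ?V i" using I(3) \<open>y \<in> L'\<close> by blast
    have "\<phi> i y \<le> (\<Sum>i\<in>I. \<phi> i y)"
      by (rule member_le_sum) (use i I \<phi>(4) in auto)
    then show ?thesis using i unfolding \<psi>_def by simp
  qed
  \<comment> \<open>The denominator never vanishes. The multipliers of \<open>f\<close> add up to
    \<open>\<psi> / max 1 \<psi>\<close>, which is 1 on \<open>L'\<close> and between 0 and 1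
    elsewhere, where \<bar>f\<bar> is already below \<open>e\<close> on \<open>L\<close>.\<close>
  let ?g = "\<lambda>i y. f y * of_real (2 * \<phi> i y / max 1 (\<psi> y))"
  have "holds (\<lambda>y. c * ?g i y)" if i: "i \<in> I" for c i
  proof -
    have "i \<in> L'" using i I by blast
    moreover have "continuous_map X euclidean (\<lambda>y. c * ?g i y)"
      using f \<phi>(2) I(2) i unfolding \<psi>_def
      by (auto simp: continuous_map_euclidean_tendsto subset_iff intro!: tendsto_intros)
    ultimately show ?thesis
      using \<phi>(1,5) unfolding null_def by auto
  qed
  then have "holds (\<lambda>y. 1 * (\<Sum>i\<in>I. ?g i y))"
    by (intro holds_sum I)
  then have "holds (\<lambda>y. f y * of_real (\<psi> y / max 1 (\<psi> y)))"
    by (rule holds_cong) (simp add: \<psi>_def sum_distrib_left sum_divide_distrib)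
  moreover have "cmod (f y * of_real (\<psi> y / max 1 (\<psi> y)) - f y) < e" if y: "y \<in> L" for y
  proof (cases "y \<in> L'")
    case True
    then show ?thesis using \<psi>1[OF True] e by simp
  next
    case False
    then have fe: "cmod (f y) < e" using y LT by (auto simp: L'_def)
    define t where "t = \<psi> y / max 1 (\<psi> y)"
    have t: "0 \<le> t" "t \<le> 1" using \<psi>0[of y] y LT by (auto simp: t_def)
    have "f y * of_real t - f y = of_real (t - 1) * f y" by (simp add: algebra_simps)
    then have "cmod (f y * of_real t - f y) = \<bar>t - 1\<bar> * cmod (f y)"
      by (simp only: norm_mult norm_of_real)
    also have "\<dots> \<le> cmod (f y)" using t by (intro mult_left_le_one_le) auto
    finally show ?thesis using fe unfolding t_def by simp
  qed
  ultimately show "\<exists>g. holds g \<and> (\<forall>x\<in>L. cmod (g x - f x) < e)" by blast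
qed

text \<open>A function small on the support is its truncation, which is small everywhere, plus a
  remainder that vanishes on the support. It is the average of the doubles of these two parts; the
  doubling is the reason for \<open>e = d / 2\<close>.\<close>

lemma barrel_neighbourhood_of_zero:
  assumes X: "completely_regular_space X" "pseudocompacts_relatively_compact X"
  shows "\<zero>\<^bsub>cfun_algebra X\<^esub> \<in> alg_topology (cfun_algebra X) interior_of B"
proof -
  let ?K = "barrel_support"
  have "relatively_compact_in X ?K"
    using X(2) relatively_pseudocompact_barrel_support
    unfolding pseudocompacts_relatively_compact_def by blast
  then have K: "compactin X ?K"
    by (simp add: relatively_compact_in_def closure_of_closedin closedin_barrel_support)
  obtain d where d: "0 < d" "\<And>f. continuous_map X euclidean f \<Longrightarrow>
      (\<And>x. x \<in> topspace X \<Longrightarrow> cmod (f x) \<le> d) \<Longrightarrow> holds f"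
    using holds_uniform_ball by blast
  define e where "e = d / 2"
  have e: "0 < e" using d by (simp add: e_def)
  \<comment> \<open>The radial retraction of the plane onto the disc of radius
    \<open>e\<close>.\<close>
  define r where "r z = of_real (e / max e (cmod z)) * z" for z :: complex
  have r_cont: "continuous_on UNIV r"
    unfolding r_def using e by (intro continuous_intros) auto
  have r_le: "cmod (r z) \<le> e" for z
    using e by (auto simp: r_def norm_mult norm_divide max_def field_simps)
  have r_id: "r z = z" if "cmod z \<le> e" for z
    using e that by (simp add: r_def max_def)
  have "h \<in> B" if h: "h \<in> cfun_carrier X" and small: "\<And>x. x \<in> ?K \<Longrightarrow> cmod (h x) < e" for h
  proof -
    have hc: "continuous_map X euclidean h" using h by (simp add: cfun_carrier_def)
    have rc: "continuous_map X euclidean (\<lambda>x. r (h x))"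
      by (rule continuous_map_compose_continuous_on[OF hc r_cont])
    have "holds (\<lambda>x. 2 * r (h x))"
    proof (rule d(2))
      show "continuous_map X euclidean (\<lambda>x. 2 * r (h x))"
        using rc by (auto simp: continuous_map_euclidean_tendsto intro!: tendsto_intros)
      show "cmod (2 * r (h x)) \<le> d" for x
        using r_le[of "h x"] by (simp add: norm_mult e_def)
    qed
    moreover have "holds (\<lambda>x. 2 * (h x - r (h x)))"
    proof (rule holds_vanishing_on_support[OF X(1)])
      show "continuous_map X euclidean (\<lambda>x. 2 * (h x - r (h x)))"
        using rc hc by (auto simp: continuous_map_euclidean_tendsto intro!: tendsto_intros)
      show "2 * (h x - r (h x)) = 0" if "x \<in> ?K" for x
        using small[OF that] r_id[of "h x"] by simp
    qed
    ultimately have "holds (\<lambda>x. 1/2 * (2 * r (h x)) + 1/2 * (2 * (h x - r (h x))))"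
      by (rule holds_convex) auto
    then have "holds h" by (rule holds_cong) (simp add: algebra_simps)
    moreover have "restrict h (topspace X) = h"
      using h by (simp add: cfun_carrier_def extensional_restrict)
    ultimately show ?thesis by (simp add: holds_def)
  qed
  then have "{h \<in> cfun_carrier X. \<forall>x\<in>?K. cmod (h x - (\<lambda>x\<in>topspace X. 0) x) < e} \<subseteq> B"
    using K compactin_subset_topspace by (fastforce simp: barrel_support_def)
  moreover have "openin (compact_open_topology X)
      {h \<in> cfun_carrier X. \<forall>x\<in>?K. cmod (h x - (\<lambda>x\<in>topspace X. 0) x) < e}"
    by (rule openin_compact_open_ball[OF _ K e, of "\<lambda>x\<in>topspace X. 0"])
      (rule restrict_in_cfun_carrier_iff[THEN iffD2], simp)
  moreover have "(\<lambda>x\<in>topspace X. 0) \<in>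
      {h \<in> cfun_carrier X. \<forall>x\<in>?K. cmod (h x - (\<lambda>x\<in>topspace X. 0) x) < e}"
    using e by simp
  ultimately show ?thesis
    unfolding interior_of_def by auto
qed

end

theorem barreled_cfun_algebra:
  assumes "tychonoff_space X" "pseudocompacts_relatively_compact X"
  shows "barreled (cfun_algebra X)"
  unfolding barreled_def
proof (intro allI impI)
  fix B assume "barrel_in (cfun_algebra X) B"
  then interpret cfun_barrel X B by unfold_locales
  show "\<zero>\<^bsub>cfun_algebra X\<^esub> \<in> alg_topology (cfun_algebra X) interior_of B"
    using assms by (intro barrel_neighbourhood_of_zero) (auto simp: tychonoff_space_def)
qed

section \<open>Invariance of barreledness under isomorphism\<close>

text \<open>Barrels are described by addition, scalar multiplication and closedness, all of which
  \<open>h\<close> carries over.\<close>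

lemma (in commutative_star_algebra) barreled_if_isomorphic_cfun_algebra:
  assumes top: "topspace (alg_topology A) = carrier A"
    and iso: "top_star_algebra_isomorphic A (cfun_algebra X)"
    and barreled: "barreled (cfun_algebra X)"
  shows "barreled A"
  unfolding barreled_def
proof (intro allI impI)
  fix D assume D: "barrel_in A D"
  obtain h where h: "h \<in> ring_iso A (cfun_algebra X)"
    and h_smult: "\<forall>c. \<forall>x\<in>carrier A. h (c \<odot> x) = c \<odot>\<^bsub>cfun_algebra X\<^esub> h x"
    and h_homeo: "homeomorphic_map (alg_topology A) (alg_topology (cfun_algebra X)) h"
    using iso unfolding top_star_algebra_isomorphic_def by blast
  have h_hom: "h \<in> ring_hom A (cfun_algebra X)"
    and h_bij: "bij_betw h (carrier A) (carrier (cfun_algebra X))"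
    using h unfolding ring_iso_def by auto
  have DA: "D \<subseteq> carrier A" using D unfolding barrel_in_def by (elim conjE)
  have h_comb: "a \<odot>\<^bsub>cfun_algebra X\<^esub> h x \<oplus>\<^bsub>cfun_algebra X\<^esub> b \<odot>\<^bsub>cfun_algebra X\<^esub> h y = h (a \<odot> x \<oplus> b \<odot> y)"
    if "x \<in> carrier A" "y \<in> carrier A" for a b x y
    by (subst ring_hom_add[OF h_hom]) (use that h_smult in \<open>simp_all only: smult_in_carrier\<close>)
  have "barrel_in (cfun_algebra X) (h ` D)"
    unfolding barrel_in_def
  proof (intro conjI)
    show "h ` D \<subseteq> carrier (cfun_algebra X)"
      using h_bij DA unfolding bij_betw_def by blast
    have D_conv: "\<forall>x\<in>D. \<forall>y\<in>D. \<forall>a b. cmod a + cmod b \<le> 1 \<longrightarrow> a \<odot> x \<oplus> b \<odot> y \<in> D"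
      using D unfolding barrel_in_def absolutely_convex_in_def by (elim conjE)
    show "absolutely_convex_in (cfun_algebra X) (h ` D)"
      unfolding absolutely_convex_in_def
    proof (intro ballI allI impI)
      fix f g a b assume "f \<in> h ` D" "g \<in> h ` D" and ab: "cmod a + cmod b \<le> 1"
      then obtain x y where xy: "x \<in> D" "y \<in> D" "f = h x" "g = h y" by blast
      then show "a \<odot>\<^bsub>cfun_algebra X\<^esub> f \<oplus>\<^bsub>cfun_algebra X\<^esub> b \<odot>\<^bsub>cfun_algebra X\<^esub> g \<in> h ` D"
        using DA h_comb[of x y a b] D_conv[rule_format, OF xy(1,2) ab] by (simp only:) blast
    qed
    have D_abs: "\<forall>x\<in>carrier A. \<exists>r>0. \<forall>c. cmod c \<le> r \<longrightarrow> c \<odot> x \<in> D"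
      using D unfolding barrel_in_def absorbing_in_def by (elim conjE)
    show "absorbing_in (cfun_algebra X) (h ` D)"
      unfolding absorbing_in_def
    proof
      fix f assume "f \<in> carrier (cfun_algebra X)"
      then obtain x where x: "x \<in> carrier A" "f = h x"
        using h_bij unfolding bij_betw_def by blast
      then obtain r where "r > 0" "\<forall>c. cmod c \<le> r \<longrightarrow> c \<odot> x \<in> D"
        using D_abs by blast
      then show "\<exists>r>0. \<forall>c. cmod c \<le> r \<longrightarrow> c \<odot>\<^bsub>cfun_algebra X\<^esub> f \<in> h ` D"
        using h_smult x by (metis imageI)
    qed
    show "closedin (alg_topology (cfun_algebra X)) (h ` D)"
      using homeomorphic_map_closedness[OF h_homeo] D DA top unfolding barrel_in_def by blast
  qed
  then have "\<zero>\<^bsub>cfun_algebra X\<^esub> \<in> h ` (alg_topology A interior_of D)"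
    using barreled homeomorphic_map_interior_of[OF h_homeo, of D] DA top
    unfolding barreled_def by blast
  then obtain z where z: "z \<in> alg_topology A interior_of D" "h z = \<zero>\<^bsub>cfun_algebra X\<^esub>"
    by auto
  have "h \<zero> = \<zero>\<^bsub>cfun_algebra X\<^esub>"
    using h_smult[rule_format, of \<zero> 0] by simp
  moreover have "z \<in> carrier A"
    using z(1) DA interior_of_subset[of "alg_topology A" D] by blast
  ultimately have "z = \<zero>"
    using h_bij z(2) unfolding bij_betw_def inj_on_def by auto
  then show "\<zero> \<in> alg_topology A interior_of D" using z(1) by simp
qed

section \<open>The space of characters\<close>

lemma open_vimage_apply: "open W \<Longrightarrow> open ((\<lambda>h :: 'a \<Rightarrow> 'b::topological_space. h i) -` W)"
  by (rule open_vimage[OF _ continuous_on_product_coordinates])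

text \<open>One coordinate at which two functions differ separates them. The aim of these instances
  is a Hausdorff type of characters, as required by the locale \<open>function_ring_on\<close> of
  the Stone-Weierstrass theorem.\<close>

instance "fun" :: (type, t0_space) t0_space
proof
  fix f g :: "'a \<Rightarrow> 'b" assume "f \<noteq> g"
  then obtain i where "f i \<noteq> g i" by blast
  then obtain U where U: "open U" "\<not> (f i \<in> U \<longleftrightarrow> g i \<in> U)"
    using t0_space_class.t0_space[OF \<open>f i \<noteq> g i\<close>] by (elim exE conjE)
  then show "\<exists>U. open U \<and> \<not> (f \<in> U \<longleftrightarrow> g \<in> U)"
    by (intro exI[of _ "(\<lambda>h. h i) -` U"]) (simp add: open_vimage_apply)
qed

instance "fun" :: (type, t1_space) t1_space
proof
  fix f g :: "'a \<Rightarrow> 'b" assume "f \<noteq> g"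
  then obtain i where "f i \<noteq> g i" by blast
  then obtain U where U: "open U" "f i \<in> U" "g i \<notin> U"
    using t1_space_class.t1_space[OF \<open>f i \<noteq> g i\<close>] by (elim exE conjE)
  then show "\<exists>U. open U \<and> f \<in> U \<and> g \<notin> U"
    by (intro exI[of _ "(\<lambda>h. h i) -` U"]) (simp add: open_vimage_apply)
qed

instance "fun" :: (type, t2_space) t2_space
proof
  fix f g :: "'a \<Rightarrow> 'b" assume "f \<noteq> g"
  then obtain i where "f i \<noteq> g i" by blast
  then obtain U V where UV: "open U" "open V" "f i \<in> U" "g i \<in> V" "U \<inter> V = {}"
    using hausdorff[OF \<open>f i \<noteq> g i\<close>] by (elim exE conjE)
  then show "\<exists>U V. open U \<and> open V \<and> f \<in> U \<and> g \<in> V \<and> U \<inter> V = {}"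
    by (intro exI[of _ "(\<lambda>h. h i) -` U"] exI[of _ "(\<lambda>h. h i) -` V"])
      (auto simp: open_vimage_apply)
qed

lemma completely_regular_space_euclidean_fun:
  "completely_regular_space (euclidean :: ('a \<Rightarrow> 'b::metric_space) topology)"
  unfolding euclidean_product_topology[symmetric] completely_regular_space_product_topology
  by (simp add: metrizable_imp_completely_regular_space metrizable_space_euclidean)

lemma Hausdorff_space_euclidean_fun:
  "Hausdorff_space (euclidean :: ('a \<Rightarrow> 'b::metric_space) topology)"
  unfolding euclidean_product_topology[symmetric] Hausdorff_space_product_topology
  by (simp add: Hausdorff_space_euclidean)

context commutative_star_algebra
begin

lemma character_simps:
  assumes "\<phi> \<in> characters_below p"
  shows "x \<notin> carrier A \<Longrightarrow> \<phi> x = 0" "\<phi> \<one> = 1"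
    "x \<in> carrier A \<Longrightarrow> y \<in> carrier A \<Longrightarrow> \<phi> (x \<oplus> y) = \<phi> x + \<phi> y"
    "x \<in> carrier A \<Longrightarrow> y \<in> carrier A \<Longrightarrow> \<phi> (x \<otimes> y) = \<phi> x * \<phi> y"
    "x \<in> carrier A \<Longrightarrow> \<phi> (c \<odot> x) = c * \<phi> x"
    "x \<in> carrier A \<Longrightarrow> \<phi> (star A x) = cnj (\<phi> x)"
    "x \<in> carrier A \<Longrightarrow> cmod (\<phi> x) \<le> p x"
  using assms unfolding characters_below_def by simp_all

lemma character_diff:
  assumes "\<phi> \<in> characters_below p" "x \<in> carrier A" "y \<in> carrier A"
  shows "\<phi> (x \<ominus> y) = \<phi> x - \<phi> y"
  using character_simps(5)[OF assms(1,3), of "- 1"] character_simps(3)[OF assms(1,2), of "\<ominus> y"] assms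
  by (simp add: a_minus_def minus_smult)

lemma characters_below_mono:
  "(\<And>x. x \<in> carrier A \<Longrightarrow> p x \<le> q x) \<Longrightarrow> characters_below p \<subseteq> characters_below q"
  unfolding characters_below_def by (auto intro: order_trans)

text \<open>The Banach-Alaoglu argument: each defining clause is a closed condition on finitely many
  coordinates, and the bound by \<open>p\<close> confines the characters to a product of discs, of
  radius 0 off the carrier.\<close>

lemma compact_characters_below: "compact (characters_below p)"
proof -
  have "closed (characters_below p)"
    unfolding characters_below_def Ball_def
    by (intro closed_Collect_conj closed_Collect_all closed_Collect_imp open_Collect_const
        closed_Collect_eq closed_Collect_le continuous_intros continuous_on_product_coordinates)
  moreover have "compact (PiE UNIV (\<lambda>x. cball 0 (if x \<in> carrier A then p x else 0) :: complex set))"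
    unfolding compactin_euclidean_iff[symmetric] euclidean_product_topology[symmetric]
    by (subst compactin_PiE) simp
  moreover have "characters_below p \<subseteq> PiE UNIV (\<lambda>x. cball 0 (if x \<in> carrier A then p x else 0))"
    using character_simps(1,7) by (auto simp: PiE_iff)
  ultimately show ?thesis
    by (metis compact_Int_closed inf.absorb_iff2)
qed

text \<open>The form in which attainment is used. The hypothesis \<open>0 < e\<close> settles
  \<open>p a = 0\<close>, where there may be no characters at all: none lies below the zero
  seminorm.\<close>

lemma seminorm_less_if_characters_less:
  assumes p: "cstar_seminorm A p" and a: "a \<in> carrier A" and e: "0 < e"
    and less: "\<And>\<phi>. \<phi> \<in> characters_below p \<Longrightarrow> cmod (\<phi> a) < e"
  shows "p a < e"
proof (cases "0 < p a")
  case True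
  then show ?thesis using character_attaining_seminorm[OF p a] less by metis
qed (use e in simp)

section \<open>Density of \<open>A\<close> in the continuous functions on the characters below a
  seminorm\<close>

lemma real_Stone_Weierstrass_characters:
  assumes g: "continuous_on (characters_below p) g" and e: "0 < e"
  obtains a where "a \<in> carrier A"
    "\<forall>\<phi>\<in>characters_below p. cmod (\<phi> a - complex_of_real (g \<phi>)) < e"
proof -
  define R where "R = {g. \<exists>a\<in>carrier A. \<forall>\<phi>\<in>characters_below p. \<phi> a = complex_of_real (g \<phi>)}"
  interpret function_ring_on R "characters_below p"
  proof
    show "compact (characters_below p)" by (rule compact_characters_below)
  next
    fix f assume "f \<in> R"
    then obtain a where a: "\<forall>\<phi>\<in>characters_below p. \<phi> a = complex_of_real (f \<phi>)"
      by (auto simp: R_def)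
    have "continuous_on (characters_below p) (\<lambda>\<phi>. Re (\<phi> a))"
      by (intro continuous_intros continuous_on_subset[OF continuous_on_product_coordinates]) auto
    then show "continuous_on (characters_below p) f"
    proof (rule continuous_on_eq)
      fix \<phi> assume "\<phi> \<in> characters_below p"
      from bspec[OF a this] show "Re (\<phi> a) = f \<phi>" by simp
    qed
  next
    fix f g assume "f \<in> R" "g \<in> R"
    then obtain a b where ab: "a \<in> carrier A" "b \<in> carrier A"
      "\<forall>\<phi>\<in>characters_below p. \<phi> a = complex_of_real (f \<phi>)"
      "\<forall>\<phi>\<in>characters_below p. \<phi> b = complex_of_real (g \<phi>)"
      by (auto simp: R_def)
    then show "(\<lambda>\<phi>. f \<phi> + g \<phi>) \<in> R"
      unfolding R_def by (auto intro!: bexI[of _ "a \<oplus> b"] simp: character_simps)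
    show "(\<lambda>\<phi>. f \<phi> * g \<phi>) \<in> R"
      using ab unfolding R_def by (auto intro!: bexI[of _ "a \<otimes> b"] simp: character_simps)
  next
    show "(\<lambda>_. c) \<in> R" for c
      unfolding R_def by (auto intro!: bexI[of _ "scalar (complex_of_real c)"] simp: character_simps)
  next
    fix \<phi> \<psi> assume \<phi>: "\<phi> \<in> characters_below p" and \<psi>: "\<psi> \<in> characters_below p" and "\<phi> \<noteq> \<psi>"
    then obtain a where "\<phi> a \<noteq> \<psi> a" by blast
    then have a: "a \<in> carrier A"
      using character_simps(1)[OF \<phi>] character_simps(1)[OF \<psi>] by metis
    \<comment> \<open>\<open>R\<close> consists of real functions, so the complex values of
      \<open>a\<close> separate only through the self-adjoint elements representing twice their real
      and imaginary parts.\<close>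
    have Re: "(\<lambda>\<phi>. 2 * Re (\<phi> a)) \<in> R"
      unfolding R_def using a
      by (auto intro!: bexI[of _ "a \<oplus> star A a"] simp: character_simps complex_add_cnj)
    have Im: "(\<lambda>\<phi>. 2 * Im (\<phi> a)) \<in> R"
      unfolding R_def
    proof (intro CollectI bexI[of _ "(- \<i>) \<odot> (a \<ominus> star A a)"] ballI)
      fix \<theta> assume \<theta>: "\<theta> \<in> characters_below p"
      show "\<theta> ((- \<i>) \<odot> (a \<ominus> star A a)) = complex_of_real (2 * Im (\<theta> a))"
        using a
        by (simp only: character_simps(5,6)[OF \<theta>] character_diff[OF \<theta>] minus_closed
            star_in_carrier) (simp add: complex_eq_iff)
    qed (use a in simp)
    show "\<exists>f\<in>R. f \<phi> \<noteq> f \<psi>"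
    proof (cases "Re (\<phi> a) = Re (\<psi> a)")
      case True
      show ?thesis
        by (rule bexI[OF _ Im]) (use True \<open>\<phi> a \<noteq> \<psi> a\<close> in \<open>simp add: complex_eq_iff\<close>)
    next
      case False
      show ?thesis
        by (rule bexI[OF _ Re]) (use False in simp)
    qed
  qed
  obtain f where "f \<in> R" and f: "\<forall>\<phi>\<in>characters_below p. \<bar>g \<phi> - f \<phi>\<bar> < e"
    using Stone_Weierstrass_basic[OF g e] by blast
  then obtain a where a: "a \<in> carrier A"
    "\<forall>\<phi>\<in>characters_below p. \<phi> a = complex_of_real (f \<phi>)"
    by (auto simp: R_def)
  have "cmod (\<phi> a - complex_of_real (g \<phi>)) < e" if "\<phi> \<in> characters_below p" for \<phi>
  proof -
    have "\<phi> a - complex_of_real (g \<phi>) = complex_of_real (f \<phi> - g \<phi>)"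
      using a(2) that by simp
    then show ?thesis
      using f that by (simp only: norm_of_real abs_minus_commute)
  qed
  then show ?thesis using that a(1) by blast
qed

lemma Stone_Weierstrass_characters:
  assumes f: "continuous_on (characters_below p) f" and e: "0 < e"
  obtains a where "a \<in> carrier A" "\<forall>\<phi>\<in>characters_below p. cmod (\<phi> a - f \<phi>) < e"
proof -
  have cont: "continuous_on (characters_below p) (\<lambda>\<phi>. Re (f \<phi>))"
    "continuous_on (characters_below p) (\<lambda>\<phi>. Im (f \<phi>))"
    using f by (auto intro!: continuous_intros)
  have e2: "0 < e / 2" using e by simp
  obtain a where a: "a \<in> carrier A"
    "\<forall>\<phi>\<in>characters_below p. cmod (\<phi> a - complex_of_real (Re (f \<phi>))) < e / 2"
    using real_Stone_Weierstrass_characters[OF cont(1) e2] .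
  obtain b where b: "b \<in> carrier A"
    "\<forall>\<phi>\<in>characters_below p. cmod (\<phi> b - complex_of_real (Im (f \<phi>))) < e / 2"
    using real_Stone_Weierstrass_characters[OF cont(2) e2] .
  have "cmod (\<phi> (a \<oplus> \<i> \<odot> b) - f \<phi>) < e" if \<phi>: "\<phi> \<in> characters_below p" for \<phi>
  proof -
    have "\<phi> (a \<oplus> \<i> \<odot> b) - f \<phi>
        = (\<phi> a - complex_of_real (Re (f \<phi>))) + \<i> * (\<phi> b - complex_of_real (Im (f \<phi>)))"
      using a b \<phi> by (subst complex_eq[of "f \<phi>"]) (simp add: character_simps algebra_simps)
    also have "cmod \<dots> \<le> cmod (\<phi> a - complex_of_real (Re (f \<phi>)))
        + cmod (\<phi> b - complex_of_real (Im (f \<phi>)))"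
      by (rule order_trans[OF norm_triangle_ineq]) (simp add: norm_mult)
    also have "\<dots> < e"
      using a(2) b(2) \<phi> by fastforce
    finally show ?thesis .
  qed
  moreover have "a \<oplus> \<i> \<odot> b \<in> carrier A" using a b by auto
  ultimately show ?thesis using that by blast
qed

end

section \<open>The Gelfand representation\<close>

sublocale unital_commutative_pro_cstar_algebra \<subseteq> commutative_star_algebra A ..

context unital_commutative_pro_cstar_algebra
begin

abbreviation "continuous_seminorms \<equiv> continuous_cstar_seminorms A"

lemma continuous_seminorms_cstar: "p \<in> continuous_seminorms \<Longrightarrow> cstar_seminorm A p"
  by (simp add: continuous_cstar_seminorms_def)

lemma zero_in_continuous_seminorms: "(\<lambda>_. 0) \<in> continuous_seminorms"
  by (simp add: continuous_cstar_seminorms_def cstar_seminorm_def)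

lemma max_in_continuous_seminorms:
  "p \<in> continuous_seminorms \<Longrightarrow> q \<in> continuous_seminorms \<Longrightarrow>
    (\<lambda>x. max (p x) (q x)) \<in> continuous_seminorms"
  by (simp add: continuous_cstar_seminorms_def cstar_seminorm_max continuous_map_real_max)

section \<open>Neighbourhoods and characters of a pro-C*-algebra\<close>

lemma openin_seminorm_ball:
  assumes "p \<in> continuous_seminorms" "x \<in> carrier A" "0 < e"
  shows "openin (alg_topology A) {y \<in> carrier A. p (y \<ominus> x) < e}"
  by (subst topology_generated, rule topology_generated_by_Basis) (use assms in blast)

text \<open>Turns the generating subbasis into neighbourhood bases: the maximum of two seminorms
  handles intersections, the triangle inequality the change of centre.\<close>

lemma openin_contains_seminorm_ball:
  assumes U: "openin (alg_topology A) U" "x \<in> U"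
  shows "\<exists>p e. p \<in> continuous_seminorms \<and> 0 < e \<and> {y \<in> carrier A. p (y \<ominus> x) < e} \<subseteq> U"
proof -
  have x: "x \<in> carrier A"
    using openin_subset[OF U(1)] U(2) topspace_alg_topology by blast
  have "generate_topology_on {{y \<in> carrier A. p (y \<ominus> x) < e} | p x e.
      p \<in> continuous_seminorms \<and> x \<in> carrier A \<and> 0 < e} U"
    using U(1) by (subst (asm) topology_generated) (simp only: openin_topology_generated_by_iff)
  then show ?thesis
    using U(2)
  proof induction
    case Empty
    then show ?case by simp
  next
    case (Int a b)
    then obtain p d q e where
      "p \<in> continuous_seminorms" "0 < d" "{y \<in> carrier A. p (y \<ominus> x) < d} \<subseteq> a"
      "q \<in> continuous_seminorms" "0 < e" "{y \<in> carrier A. q (y \<ominus> x) < e} \<subseteq> b"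
      by auto
    then show ?case
      by (intro exI[of _ "\<lambda>x. max (p x) (q x)"] exI[of _ "min d e"] conjI)
        (auto simp: max_in_continuous_seminorms)
  next
    case (UN C)
    then obtain a where a: "a \<in> C" "x \<in> a" by blast
    then obtain p e where "p \<in> continuous_seminorms \<and> 0 < e \<and> {y \<in> carrier A. p (y \<ominus> x) < e} \<subseteq> a"
      using UN.IH[OF a] by (elim exE)
    then show ?case
      using a(1) by (intro exI[of _ p] exI[of _ e]) (auto dest: subsetD)
  next
    case (Basis s)
    then obtain p z e where s: "s = {y \<in> carrier A. p (y \<ominus> z) < e}"
      and p: "p \<in> continuous_seminorms" and z: "z \<in> carrier A"
      by blast
    have "p (x \<ominus> z) < e" using Basis(2) unfolding s by simp
    moreover have "p (y \<ominus> z) \<le> p (y \<ominus> x) + p (x \<ominus> z)" if "y \<in> carrier A" for y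
      using seminorm_diff_triangle[OF continuous_seminorms_cstar[OF p] that x z] .
    ultimately have "{y \<in> carrier A. p (y \<ominus> x) < e - p (x \<ominus> z)} \<subseteq> s" "0 < e - p (x \<ominus> z)"
      unfolding s by force+
    then show ?case using p by (intro exI[of _ p] exI[of _ "e - p (x \<ominus> z)"] conjI)
  qed
qed

text \<open>These are all the continuous star characters, because the absolute value of such a
  character is itself a continuous C*-seminorm. The topology inherited from the function type is the
  weak one.\<close>

definition spectrum :: "('a \<Rightarrow> complex) set" where
  "spectrum = (\<Union>p\<in>continuous_seminorms. characters_below p)"

lemma characters_below_subset_spectrum: "p \<in> continuous_seminorms \<Longrightarrow> characters_below p \<subseteq> spectrum"
  by (auto simp: spectrum_def)

lemma tychonoff_space_spectrum: "tychonoff_space (top_of_set spectrum)"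
  unfolding tychonoff_space_def
  by (intro conjI Hausdorff_imp_t1_space Hausdorff_space_subtopology Hausdorff_space_euclidean_fun
      completely_regular_space_subtopology completely_regular_space_euclidean_fun)

lemma compactin_characters_below:
  "p \<in> continuous_seminorms \<Longrightarrow> compactin (top_of_set spectrum) (characters_below p)"
  by (simp add: compactin_subtopology compact_characters_below characters_below_subset_spectrum)

definition gelfand :: "'a \<Rightarrow> ('a \<Rightarrow> complex) \<Rightarrow> complex" where
  "gelfand a = (\<lambda>\<phi>\<in>spectrum. \<phi> a)"

lemma gelfand_apply [simp]: "\<phi> \<in> spectrum \<Longrightarrow> gelfand a \<phi> = \<phi> a"
  by (simp add: gelfand_def)

lemma gelfand_in_cfun_carrier: "gelfand a \<in> cfun_carrier (top_of_set spectrum)"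
proof -
  have "continuous_map (top_of_set spectrum) euclidean (\<lambda>\<phi>. \<phi> a)"
    by (simp add: continuous_on_subset[OF continuous_on_product_coordinates])
  then show ?thesis
    using restrict_in_cfun_carrier_iff[of "\<lambda>\<phi>. \<phi> a" "top_of_set spectrum"]
    by (simp add: gelfand_def)
qed

lemma gelfand_inj: "inj_on gelfand (carrier A)"
proof (rule inj_onI, rule ccontr)
  fix a b assume a: "a \<in> carrier A" and b: "b \<in> carrier A"
    and eq: "gelfand a = gelfand b" and "a \<noteq> b"
  have "\<exists>U V. openin (alg_topology A) U \<and> openin (alg_topology A) V \<and> a \<in> U \<and> b \<in> V \<and> disjnt U V"
    by (rule hausdorff[unfolded Hausdorff_space_def, rule_format])
      (simp add: a b \<open>a \<noteq> b\<close> topspace_alg_topology)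
  then obtain V where V: "openin (alg_topology A) V" "b \<in> V" "a \<notin> V"
    by (auto simp: disjnt_iff)
  obtain p e where p: "p \<in> continuous_seminorms" "0 < e" "{y \<in> carrier A. p (y \<ominus> b) < e} \<subseteq> V"
    using openin_contains_seminorm_ball[OF V(1,2)] by (elim exE conjE)
  have "p (a \<ominus> b) < e"
  proof (rule seminorm_less_if_characters_less)
    fix \<phi> assume \<phi>: "\<phi> \<in> characters_below p"
    then have "\<phi> \<in> spectrum" using characters_below_subset_spectrum[OF p(1)] by blast
    then have "\<phi> a = \<phi> b" using eq by (metis gelfand_apply)
    then show "cmod (\<phi> (a \<ominus> b)) < e" using character_diff[OF \<phi> a b] p(2) by simp
  qed (use p a b continuous_seminorms_cstar in auto)
  then show False using p(3) a V(3) by blast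
qed

text \<open>For continuous \<open>f\<close> on the spectrum, the elements approximating \<open>f\<close> uniformly on the compact
  sets of characters below a seminorm form a Cauchy filter.\<close>

lemma gelfand_surj:
  assumes f: "f \<in> cfun_carrier (top_of_set spectrum)"
  obtains a where "a \<in> carrier A" "gelfand a = f"
proof -
  define D where "D p e = {a \<in> carrier A. \<forall>\<phi>\<in>characters_below p. cmod (\<phi> a - f \<phi>) < e}"
    for p and e :: real
  define I where "I = continuous_seminorms \<times> {0::real<..}"
  \<comment> \<open>The sets \<open>D p e\<close> are nonempty by Stone-Weierstrass and directed
    because the characters below a maximum include those below either seminorm.\<close>
  define F where "F = (INF (p, e)\<in>I. principal (D p e))"
  have fc: "continuous_on spectrum f"
    using f by (simp add: cfun_carrier_def)
  have D_nonempty: "D p e \<noteq> {}" if p: "p \<in> continuous_seminorms" and e: "0 < e" for p e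
  proof -
    have "continuous_on (characters_below p) f"
      using fc characters_below_subset_spectrum[OF p] by (rule continuous_on_subset)
    then obtain a where "a \<in> carrier A" "\<forall>\<phi>\<in>characters_below p. cmod (\<phi> a - f \<phi>) < e"
      using e by (rule Stone_Weierstrass_characters)
    then show ?thesis unfolding D_def by blast
  qed
  have D_max: "D (\<lambda>x. max (p x) (q x)) (min d e) \<subseteq> D p d \<inter> D q e" for p q d e
    using characters_below_mono[of p "\<lambda>x. max (p x) (q x)"]
      characters_below_mono[of q "\<lambda>x. max (p x) (q x)"]
    unfolding D_def by fastforce
  have ev: "eventually P F \<longleftrightarrow> (\<exists>(p, e)\<in>I. \<forall>a\<in>D p e. P a)" for P
    unfolding F_def
  proof (subst eventually_INF_base)
    show "I \<noteq> {}" using zero_in_continuous_seminorms by (auto simp: I_def intro: gt_ex)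
    fix i j assume I: "i \<in> I" "j \<in> I"
    obtain p d q e where ij: "i = (p, d)" "j = (q, e)"
      by (cases i, cases j)
    show "\<exists>k\<in>I. (case k of (p, e) \<Rightarrow> principal (D p e))
        \<le> inf (case i of (p, e) \<Rightarrow> principal (D p e)) (case j of (p, e) \<Rightarrow> principal (D p e))"
      using I D_max[of p q d e] unfolding ij
      by (intro bexI[of _ "(\<lambda>x. max (p x) (q x), min d e)"])
        (auto simp: I_def max_in_continuous_seminorms)
  qed (auto simp: eventually_principal split_def)
  have "cauchy_filter_on A F"
    unfolding cauchy_filter_on_def
  proof (intro conjI allI impI)
    show "F \<noteq> bot"
      using D_nonempty ev[of "\<lambda>_. False"] by (auto simp: I_def eventually_False[symmetric])
    have "eventually (\<lambda>x. x \<in> carrier A) F"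
      using zero_in_continuous_seminorms unfolding ev
      by (intro bexI[of _ "(\<lambda>_. 0, 1)"]) (auto simp: I_def D_def)
    then show "F \<le> principal (carrier A)" by (simp add: le_principal)
    fix U assume U: "openin (alg_topology A) U \<and> \<zero> \<in> U"
    obtain p e where p: "p \<in> continuous_seminorms" "0 < e" "{y \<in> carrier A. p (y \<ominus> \<zero>) < e} \<subseteq> U"
      using openin_contains_seminorm_ball[OF conjunct1[OF U] conjunct2[OF U]] by (elim exE conjE)
    \<comment> \<open>Two approximants differ by less than \<open>e\<close> at every character below
      \<open>p\<close>, and these characters determine \<open>p\<close>.\<close>
    have "x \<ominus> y \<in> U" if x: "x \<in> D p (e / 2)" and y: "y \<in> D p (e / 2)" for x y
    proof -
      have xA: "x \<in> carrier A" and yA: "y \<in> carrier A" using x y by (auto simp: D_def)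
      have "p (x \<ominus> y) < e"
      proof (rule seminorm_less_if_characters_less)
        fix \<phi> assume \<phi>: "\<phi> \<in> characters_below p"
        have "cmod (\<phi> x - f \<phi>) < e / 2" "cmod (\<phi> y - f \<phi>) < e / 2"
          using x y \<phi> by (auto simp: D_def)
        then show "cmod (\<phi> (x \<ominus> y)) < e"
          unfolding character_diff[OF \<phi> xA yA] by norm
      qed (use p xA yA continuous_seminorms_cstar in auto)
      then show ?thesis using p(3) xA yA by (auto simp: a_minus_def)
    qed
    moreover have "D p (e / 2) \<subseteq> carrier A" by (auto simp: D_def)
    moreover have "eventually (\<lambda>x. x \<in> D p (e / 2)) F"
      using p(1,2) unfolding ev by (intro bexI[of _ "(p, e / 2)"]) (auto simp: I_def)
    ultimately show "\<exists>B\<subseteq>carrier A. eventually (\<lambda>x. x \<in> B) F \<and> (\<forall>x\<in>B. \<forall>y\<in>B. x \<ominus> y \<in> U)"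
      by (intro exI[of _ "D p (e / 2)"]) blast
  qed
  then have "F \<noteq> bot" and "\<exists>l. limitin (alg_topology A) (\<lambda>x. x) l F"
    using complete unfolding complete_top_star_algebra_def cauchy_filter_on_def by auto
  then obtain l where l: "limitin (alg_topology A) (\<lambda>x. x) l F" by blast
  then have lA: "l \<in> carrier A" by (simp add: limitin_def topspace_alg_topology)
  have "\<phi> l = f \<phi>" if "\<phi> \<in> spectrum" for \<phi>
  proof -
    obtain p where p: "p \<in> continuous_seminorms" and \<phi>: "\<phi> \<in> characters_below p"
      using \<open>\<phi> \<in> spectrum\<close> by (auto simp: spectrum_def)
    have "cmod (\<phi> l - f \<phi>) \<le> 0"
    proof (rule field_le_epsilon)
      fix e :: real assume e: "0 < e"
      let ?U = "{y \<in> carrier A. p (y \<ominus> l) < e / 2}"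
      have "l \<in> ?U"
        using lA e seminorm_zero[OF continuous_seminorms_cstar[OF p]] by (simp add: a_minus_def r_neg)
      moreover have "openin (alg_topology A) ?U"
        by (rule openin_seminorm_ball[OF p lA]) (use e in simp)
      ultimately have "eventually (\<lambda>y. y \<in> ?U) F"
        using l unfolding limitin_def by blast
      moreover have "eventually (\<lambda>x. x \<in> D p (e / 2)) F"
        using p e unfolding ev by (intro bexI[of _ "(p, e / 2)"]) (auto simp: I_def)
      ultimately have "eventually (\<lambda>y. y \<in> ?U \<and> y \<in> D p (e / 2)) F"
        by (rule eventually_conj)
      then obtain y where y: "y \<in> ?U" "y \<in> D p (e / 2)"
        using eventually_happens'[OF \<open>F \<noteq> bot\<close>] by blast
      then have "cmod (\<phi> y - \<phi> l) < e / 2" "cmod (\<phi> y - f \<phi>) < e / 2"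
        using character_simps(7)[OF \<phi>, of "y \<ominus> l"] character_diff[OF \<phi>, of y l] lA \<phi>
        by (auto simp: D_def)
      then show "cmod (\<phi> l - f \<phi>) \<le> 0 + e" by norm
    qed
    then show ?thesis by simp
  qed
  then have "gelfand l = f"
    using f by (intro extensionalityI[of _ spectrum]) (auto simp: gelfand_def cfun_carrier_def)
  then show ?thesis using that lA by blast
qed

lemma gelfand_image: "gelfand ` carrier A = cfun_carrier (top_of_set spectrum)"
proof
  show "gelfand ` carrier A \<subseteq> cfun_carrier (top_of_set spectrum)"
    using gelfand_in_cfun_carrier by blast
  show "cfun_carrier (top_of_set spectrum) \<subseteq> gelfand ` carrier A"
  proof
    fix f assume "f \<in> cfun_carrier (top_of_set spectrum)"
    then show "f \<in> gelfand ` carrier A" by (rule gelfand_surj) blast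
  qed
qed

lemma gelfand_ring_iso: "gelfand \<in> ring_iso A (cfun_algebra (top_of_set spectrum))"
proof (rule ring_iso_memI)
  show "bij_betw gelfand (carrier A) (carrier (cfun_algebra (top_of_set spectrum)))"
    using gelfand_inj gelfand_image by (simp add: bij_betw_def)
  show "gelfand x \<in> carrier (cfun_algebra (top_of_set spectrum))" for x
    by (simp add: gelfand_in_cfun_carrier)
qed (auto simp: gelfand_def spectrum_def character_simps fun_eq_iff restrict_def)

text \<open>Uniform smallness on the compact set \<open>characters_below p\<close> forces
  \<open>p\<close> to be small, so a seminorm ball contains the preimage of a compact-open
  ball.\<close>

lemma open_map_gelfand:
  "open_map (alg_topology A) (compact_open_topology (top_of_set spectrum)) gelfand"
  unfolding open_map_def
proof (intro allI impI)
  fix U assume U: "openin (alg_topology A) U"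
  show "openin (compact_open_topology (top_of_set spectrum)) (gelfand ` U)"
  proof (subst openin_subopen, intro ballI)
    fix f assume "f \<in> gelfand ` U"
    then obtain a where a: "a \<in> U" "f = gelfand a" by blast
    have aA: "a \<in> carrier A"
      using openin_subset[OF U] a(1) topspace_alg_topology by blast
    obtain p e where p: "p \<in> continuous_seminorms" "0 < e" "{y \<in> carrier A. p (y \<ominus> a) < e} \<subseteq> U"
      using openin_contains_seminorm_ball[OF U a(1)] by (elim exE conjE)
    note sub = characters_below_subset_spectrum[OF p(1)]
    let ?V = "{g \<in> cfun_carrier (top_of_set spectrum). \<forall>\<phi>\<in>characters_below p. cmod (g \<phi> - f \<phi>) < e}"
    have "?V \<subseteq> gelfand ` U"
    proof
      fix g assume g: "g \<in> ?V"
      then have "g \<in> gelfand ` carrier A" using gelfand_image by blast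
      then obtain y where y: "y \<in> carrier A" "g = gelfand y" by blast
      have "p (y \<ominus> a) < e"
      proof (rule seminorm_less_if_characters_less)
        fix \<phi> assume \<phi>: "\<phi> \<in> characters_below p"
        then have "\<phi> \<in> spectrum" using sub by blast
        then show "cmod (\<phi> (y \<ominus> a)) < e"
          using g \<phi> y a(2) character_diff[OF \<phi> y(1) aA] by auto
      qed (use p y aA continuous_seminorms_cstar in auto)
      then show "g \<in> gelfand ` U" using p(3) y by blast
    qed
    moreover have "openin (compact_open_topology (top_of_set spectrum)) ?V"
      using a(2) gelfand_in_cfun_carrier compactin_characters_below[OF p(1)] p(2)
      by (intro openin_compact_open_ball) auto
    moreover have "f \<in> ?V"
      using a(2) gelfand_in_cfun_carrier p(2) by simp
    ultimately show "\<exists>T. openin (compact_open_topology (top_of_set spectrum)) T \<and> f \<in> T \<and>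
        T \<subseteq> gelfand ` U"
      by (intro exI[of _ ?V] conjI)
  qed
qed

section \<open>Consequences of barreledness\<close>

context
  assumes barreled: "barreled A"
begin

text \<open>The polar of a relatively pseudocompact set of characters is a barrel.\<close>

lemma relatively_pseudocompact_subset_characters_below:
  assumes S: "relatively_pseudocompact_in (top_of_set spectrum) S"
  obtains p where "p \<in> continuous_seminorms" "S \<subseteq> characters_below p"
proof -
  have S_spec: "S \<subseteq> spectrum"
    using S by (simp add: relatively_pseudocompact_in_def)
  define B where "B = {a \<in> carrier A. \<forall>\<phi>\<in>S. cmod (\<phi> a) \<le> 1}"
  have char: "\<exists>p\<in>continuous_seminorms. \<phi> \<in> characters_below p" if "\<phi> \<in> S" for \<phi>
    using that S_spec by (auto simp: spectrum_def)
  have "barrel_in A B"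
    unfolding barrel_in_def
  proof (intro conjI)
    show "B \<subseteq> carrier A" by (auto simp: B_def)
    show "absolutely_convex_in A B"
      unfolding absolutely_convex_in_def
    proof (intro ballI allI impI)
      fix x y a b assume x: "x \<in> B" and y: "y \<in> B" and ab: "cmod a + cmod b \<le> 1"
      have "cmod (\<phi> (a \<odot> x \<oplus> b \<odot> y)) \<le> 1" if "\<phi> \<in> S" for \<phi>
      proof -
        obtain p where \<phi>: "\<phi> \<in> characters_below p" using char[OF \<open>\<phi> \<in> S\<close>] by blast
        have "cmod (\<phi> (a \<odot> x \<oplus> b \<odot> y)) = cmod (a * \<phi> x + b * \<phi> y)"
          using x y by (simp add: B_def character_simps[OF \<phi>])
        also have "\<dots> \<le> cmod a * cmod (\<phi> x) + cmod b * cmod (\<phi> y)"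
          by (rule order_trans[OF norm_triangle_ineq]) (simp add: norm_mult)
        also have "\<dots> \<le> cmod a * 1 + cmod b * 1"
          using x y that by (intro add_mono mult_left_mono) (auto simp: B_def)
        finally show ?thesis using ab by simp
      qed
      then show "a \<odot> x \<oplus> b \<odot> y \<in> B" using x y by (auto simp: B_def)
    qed
    show "absorbing_in A B"
      unfolding absorbing_in_def
    proof
      fix x assume x: "x \<in> carrier A"
      have "continuous_on spectrum (\<lambda>\<phi>. cmod (\<phi> x))"
        by (intro continuous_intros continuous_on_subset[OF continuous_on_product_coordinates]) auto
      \<comment> \<open>Evaluation at \<open>x\<close> is continuous on the spectrum, so relative
        pseudocompactness makes the polar absorbing.\<close>
      then have "bounded ((\<lambda>\<phi>. cmod (\<phi> x)) ` S)"
        using S by (simp add: relatively_pseudocompact_in_def)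
      then obtain M where M: "0 < M" "\<forall>y\<in>(\<lambda>\<phi>. cmod (\<phi> x)) ` S. norm y \<le> M"
        unfolding bounded_pos by (elim exE conjE)
      have "c \<odot> x \<in> B" if c: "cmod c \<le> 1 / M" for c
      proof -
        have "cmod (\<phi> (c \<odot> x)) \<le> 1" if "\<phi> \<in> S" for \<phi>
        proof -
          obtain p where \<phi>: "\<phi> \<in> characters_below p" using char[OF \<open>\<phi> \<in> S\<close>] by blast
          have "cmod (\<phi> (c \<odot> x)) = cmod c * cmod (\<phi> x)"
            using x by (simp add: character_simps[OF \<phi>] norm_mult)
          also have "\<dots> \<le> (1 / M) * M"
            using M that by (intro mult_mono c) auto
          finally show ?thesis using M(1) by simp
        qed
        then show ?thesis using x by (auto simp: B_def)
      qed
      then show "\<exists>r>0. \<forall>c. cmod c \<le> r \<longrightarrow> c \<odot> x \<in> B"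
        using M(1) by (intro exI[of _ "1 / M"]) auto
    qed
    have "openin (alg_topology A) (carrier A - B)"
    proof (subst openin_subopen, intro ballI)
      fix x assume "x \<in> carrier A - B"
      then obtain \<phi> where x: "x \<in> carrier A" and "\<phi> \<in> S" and gt: "1 < cmod (\<phi> x)"
        by (auto simp: B_def not_le)
      then obtain p where p: "p \<in> continuous_seminorms" and \<phi>: "\<phi> \<in> characters_below p"
        using char by blast
      let ?V = "{y \<in> carrier A. p (y \<ominus> x) < cmod (\<phi> x) - 1}"
      have "1 < cmod (\<phi> y)" if y: "y \<in> ?V" for y
      proof -
        have "cmod (\<phi> y - \<phi> x) < cmod (\<phi> x) - 1"
          using character_simps(7)[OF \<phi>, of "y \<ominus> x"] character_diff[OF \<phi>, of y x] x y by auto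
        then show ?thesis by norm
      qed
      then have "?V \<subseteq> carrier A - B"
        using \<open>\<phi> \<in> S\<close> by (force simp: B_def)
      moreover have "x \<in> ?V"
        using x gt seminorm_zero[OF continuous_seminorms_cstar[OF p]] by (simp add: a_minus_def r_neg)
      moreover have "openin (alg_topology A) ?V"
        using openin_seminorm_ball[OF p x] gt by simp
      ultimately show "\<exists>T. openin (alg_topology A) T \<and> x \<in> T \<and> T \<subseteq> carrier A - B"
        by blast
    qed
    then show "closedin (alg_topology A) B"
      by (auto simp: closedin_def topspace_alg_topology B_def)
  qed
  then have "\<zero> \<in> alg_topology A interior_of B"
    using barreled by (simp add: barreled_def)
  from openin_contains_seminorm_ball[OF openin_interior_of this]
  obtain p e where p: "p \<in> continuous_seminorms" "0 < e"
      "{y \<in> carrier A. p (y \<ominus> \<zero>) < e} \<subseteq> alg_topology A interior_of B"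
    by (elim exE conjE)
  have in_B: "a \<in> B" if "a \<in> carrier A" "p a < e" for a
    using p(3) that interior_of_subset[of "alg_topology A" B] by (auto simp: a_minus_def)
  have "S \<subseteq> characters_below p"
  proof (rule ccontr)
    \<comment> \<open>By complete regularity and surjectivity of the Gelfand map some
      \<open>a\<close> vanishes on the closed set \<open>characters_below p\<close> and has the
      value 2 at \<open>\<psi>\<close>. The first fact puts \<open>a\<close> into the polar
      \<open>B\<close>, where values on \<open>S\<close> are at most 1.\<close>
    assume "\<not> S \<subseteq> characters_below p"
    then obtain \<psi> where \<psi>: "\<psi> \<in> S" "\<psi> \<notin> characters_below p" by blast
    have "Hausdorff_space (top_of_set spectrum)"
      by (rule tychonoff_imp_Hausdorff_space[OF tychonoff_space_spectrum])
    then have "closedin (top_of_set spectrum) (characters_below p)"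
      using compactin_characters_below[OF p(1)] by (rule compactin_imp_closedin)
    moreover have "\<psi> \<in> topspace (top_of_set spectrum) - characters_below p"
      using \<psi> S_spec by auto
    ultimately obtain g where g: "continuous_map (top_of_set spectrum) (top_of_set {0..1::real}) g"
        "g \<psi> = 0" "g ` characters_below p \<subseteq> {1}"
      using tychonoff_space_spectrum unfolding tychonoff_space_def completely_regular_space_def
      by meson
    have "continuous_on spectrum g"
      using g(1) by (simp add: continuous_map_in_subtopology)
    then have "continuous_map (top_of_set spectrum) euclidean (\<lambda>\<phi>. complex_of_real (2 * (1 - g \<phi>)))"
      by (auto intro!: continuous_intros)
    then have "restrict (\<lambda>\<phi>. complex_of_real (2 * (1 - g \<phi>))) spectrum
        \<in> cfun_carrier (top_of_set spectrum)"
      using restrict_in_cfun_carrier_iff[of _ "top_of_set spectrum"] by simp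
    then obtain a where a: "a \<in> carrier A"
      "gelfand a = restrict (\<lambda>\<phi>. complex_of_real (2 * (1 - g \<phi>))) spectrum"
      by (rule gelfand_surj)
    have a_eq: "\<phi> a = complex_of_real (2 * (1 - g \<phi>))" if "\<phi> \<in> spectrum" for \<phi>
      using fun_cong[OF a(2), of \<phi>] that by simp
    have "p a < e"
    proof (rule seminorm_less_if_characters_less)
      fix \<phi> assume \<phi>: "\<phi> \<in> characters_below p"
      then have "\<phi> \<in> spectrum" "g \<phi> = 1"
        using characters_below_subset_spectrum[OF p(1)] g(3) by auto
      then have "\<phi> a = 0" using a_eq[of \<phi>] by simp
      then show "cmod (\<phi> a) < e" using p(2) by simp
    qed (use p a continuous_seminorms_cstar in auto)
    then have "cmod (\<psi> a) \<le> 1"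
      using in_B[OF a(1)] \<psi>(1) by (auto simp: B_def)
    moreover have "\<psi> a = 2" using a_eq[of \<psi>] \<psi>(1) S_spec g(2) by auto
    ultimately show False by simp
  qed
  then show ?thesis using that p(1) by blast
qed

lemma pseudocompacts_relatively_compact_spectrum:
  "pseudocompacts_relatively_compact (top_of_set spectrum)"
  unfolding pseudocompacts_relatively_compact_def relatively_compact_in_def
proof (intro allI impI conjI)
  fix S assume S: "relatively_pseudocompact_in (top_of_set spectrum) S"
  then show "S \<subseteq> topspace (top_of_set spectrum)"
    by (simp add: relatively_pseudocompact_in_def)
  obtain p where p: "p \<in> continuous_seminorms" "S \<subseteq> characters_below p"
    using relatively_pseudocompact_subset_characters_below[OF S] .
  note K = compactin_characters_below[OF p(1)]
  have "closedin (top_of_set spectrum) (characters_below p)"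
    using tychonoff_imp_Hausdorff_space[OF tychonoff_space_spectrum] K
    by (rule compactin_imp_closedin)
  then have "top_of_set spectrum closure_of S \<subseteq> characters_below p"
    using p(2) by (intro closure_of_minimal)
  then show "compactin (top_of_set spectrum) (top_of_set spectrum closure_of S)"
    using closed_compactin[OF K] by simp
qed

text \<open>A compact set of characters is relatively pseudocompact, hence lies below one continuous
  seminorm \<open>p\<close>, which then dominates uniform convergence on that set.\<close>

lemma continuous_map_gelfand:
  "continuous_map (alg_topology A) (compact_open_topology (top_of_set spectrum)) gelfand"
  unfolding continuous_map_def
proof (intro conjI allI impI)
  show "gelfand \<in> topspace (alg_topology A) \<rightarrow> topspace (compact_open_topology (top_of_set spectrum))"
    using gelfand_in_cfun_carrier by simp
  fix V assume V: "openin (compact_open_topology (top_of_set spectrum)) V"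
  show "openin (alg_topology A) {a \<in> topspace (alg_topology A). gelfand a \<in> V}"
  proof (subst openin_subopen, intro ballI)
    fix a assume "a \<in> {a \<in> topspace (alg_topology A). gelfand a \<in> V}"
    then have a: "a \<in> carrier A" "gelfand a \<in> V" by (auto simp: topspace_alg_topology)
    obtain K e where K: "compactin (top_of_set spectrum) K" "0 < e"
      "{g \<in> cfun_carrier (top_of_set spectrum). \<forall>\<phi>\<in>K. cmod (g \<phi> - gelfand a \<phi>) < e} \<subseteq> V"
      using openin_compact_open_contains_ball[OF V a(2)] by (elim exE conjE)
    obtain p where p: "p \<in> continuous_seminorms" "K \<subseteq> characters_below p"
      using relatively_pseudocompact_subset_characters_below
        [OF compactin_imp_relatively_pseudocompact[OF K(1)]] .
    let ?U = "{y \<in> carrier A. p (y \<ominus> a) < e}"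
    have "gelfand y \<in> V" if y: "y \<in> ?U" for y
    proof -
      have "cmod (gelfand y \<phi> - gelfand a \<phi>) < e" if "\<phi> \<in> K" for \<phi>
      proof -
        have \<phi>: "\<phi> \<in> characters_below p" "\<phi> \<in> spectrum"
          using that p characters_below_subset_spectrum by auto
        then show ?thesis
          using character_simps(7)[OF \<phi>(1), of "y \<ominus> a"] character_diff[OF \<phi>(1), of y a] a y by auto
      qed
      then show ?thesis using K(3) gelfand_in_cfun_carrier by blast
    qed
    then have "?U \<subseteq> {a \<in> topspace (alg_topology A). gelfand a \<in> V}"
      by (auto simp: topspace_alg_topology)
    moreover have "a \<in> ?U"
      using a K(2) seminorm_zero[OF continuous_seminorms_cstar[OF p(1)]]
      by (simp add: a_minus_def r_neg)
    ultimately show "\<exists>T. openin (alg_topology A) T \<and> a \<in> T \<and>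
        T \<subseteq> {a \<in> topspace (alg_topology A). gelfand a \<in> V}"
      using openin_seminorm_ball[OF p(1) a(1) K(2)] by blast
  qed
qed

lemma homeomorphic_map_gelfand:
  "homeomorphic_map (alg_topology A) (compact_open_topology (top_of_set spectrum)) gelfand"
  using continuous_map_gelfand open_map_gelfand gelfand_inj gelfand_image
  by (intro bijective_open_imp_homeomorphic_map) (simp_all add: topspace_alg_topology)

lemma isomorphic_cfun_algebra_spectrum:
  "top_star_algebra_isomorphic A (cfun_algebra (top_of_set spectrum))"
  unfolding top_star_algebra_isomorphic_def
proof (intro bexI[of _ gelfand] conjI allI ballI)
  fix c x assume "x \<in> carrier A"
  then show "gelfand (c \<odot> x) = c \<odot>\<^bsub>cfun_algebra (top_of_set spectrum)\<^esub> gelfand x"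
    "gelfand (star A x) = star (cfun_algebra (top_of_set spectrum)) (gelfand x)"
    by (auto simp: gelfand_def spectrum_def character_simps fun_eq_iff restrict_def)
qed (simp_all add: homeomorphic_map_gelfand gelfand_ring_iso)

end

end

text \<open>Types cannot be quantified inside a formula. Existence of the space is therefore stated
  on the type of the spectrum, and sufficiency once more for spaces over an arbitrary type.\<close>

theorem theorem3p20:
  shows "(\<forall>A :: 'a top_star_algebra. unital_commutative_pro_cstar_algebra A \<longrightarrow>
            (barreled A \<longleftrightarrow>
              (\<exists>X :: ('a \<Rightarrow> complex) topology.
                 tychonoff_space X \<and> pseudocompacts_relatively_compact X \<and>
                 top_star_algebra_isomorphic A (cfun_algebra X))) \<and>
            (\<forall>X :: 'x topology.
                 tychonoff_space X \<and> pseudocompacts_relatively_compact X \<and>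
                 top_star_algebra_isomorphic A (cfun_algebra X) \<longrightarrow> barreled A)) \<and>
         (\<forall>X :: 'y topology.
            functionally_Hausdorff_space X \<and> k_space X \<and> pseudocompacts_relatively_compact X \<longrightarrow>
            (\<forall>K. (compactin (tychonoff_reflection X) K \<longleftrightarrow> compactin X K) \<and>
                 (compactin X K \<longrightarrow>
                    subtopology (tychonoff_reflection X) K = subtopology X K)))"
proof (intro conjI allI impI)
  fix A :: "'a top_star_algebra" assume "unital_commutative_pro_cstar_algebra A"
  then interpret unital_commutative_pro_cstar_algebra A .
  note if_isomorphic = barreled_if_isomorphic_cfun_algebra[OF topspace_alg_topology]
  show "barreled A \<longleftrightarrow> (\<exists>X :: ('a \<Rightarrow> complex) topology.
      tychonoff_space X \<and> pseudocompacts_relatively_compact X \<and>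
      top_star_algebra_isomorphic A (cfun_algebra X))"
    using tychonoff_space_spectrum pseudocompacts_relatively_compact_spectrum
      isomorphic_cfun_algebra_spectrum if_isomorphic barreled_cfun_algebra by blast
  fix X :: "'x topology"
  assume "tychonoff_space X \<and> pseudocompacts_relatively_compact X \<and>
      top_star_algebra_isomorphic A (cfun_algebra X)"
  then show "barreled A"
    using if_isomorphic barreled_cfun_algebra by blast
next
  fix X :: "'y topology" and K
  assume X: "functionally_Hausdorff_space X \<and> k_space X \<and> pseudocompacts_relatively_compact X"
  show "compactin (tychonoff_reflection X) K \<longleftrightarrow> compactin X K"
    using X compactin_tychonoff_reflection_iff by blast
  show "subtopology (tychonoff_reflection X) K = subtopology X K" if "compactin X K"
    using X that subtopology_tychonoff_reflection_compact by blast
qed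

end
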